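(* Let $m=2$, $n\geqslant 1$, let $\mathbf{k}$ be a differential field of characteristic zero with $m=2$ commuting derivations, let $Y=\{y_1,\dots,y_n\}$ be differential indeterminates, let $w$ be a weight on $\Theta$, and fix a weighted ranking (with respect to $w$) on $\Theta Y$. Let $F,K\subseteq\mathbf{k}\{Y\}$ be finite subsets, let $h=\mathcal{W}(F\cup K)$, and let $\{f(n,h)_k\}_{k\geqslant 0}$ be the sequence defined by $$\begin{cases} f(n,h)_0=0,\quad f(n,h)_1=f(n,h)_2=h,\\ f(n,h)_k=f(n,h)_{k-1}+f(n,h)_{k-2} & \text{for } 3\leqslant k\leqslant n+1,\\ f(n,h)_k=f(n,h)_{k-1}+f(n,h)_{k-2}-1 & \text{for } k\geqslant 3,\ k>n+1.\end{cases}$$ Let $f(i)=f(n,h)_i$ for $i\geqslant 1$, let $L=\mathfrak{L}^n_{f,2}$, and let $\mathcal{A}=\textsf{Rosenfeld-Gröbner}(F,K)$. Then $$\mathcal{W}\left(\bigcup_{(A,H)\in\mathcal{A}}(A\cup H)\right)\leqslant f(n,h)_{L+1}.$$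
   Context: Differential algebra (stated for general $m$; here $m=2$). $\mathbf{k}$ is a differential field of characteristic zero with commuting derivations $\Delta=\{\partial_1,\dots,\partial_m\}$; $\Theta=\{\partial_1^{i_1}\cdots\partial_m^{i_m}: i_j\in\mathbb{Z}_{\geqslant 0}\}$; $\Theta Y=\{\theta y:\theta\in\Theta,y\in Y\}$; $\mathbf{k}\{Y\}=\mathbf{k}[\theta y:\theta y\in\Theta Y]$ with the natural derivations. For fixed positive integers $c_1,\dots,c_m$, the weight is $w(\partial_1^{i_1}\cdots\partial_m^{i_m})=c_1i_1+\cdots+c_mi_m$, and $w(\theta y)=w(\theta)$. For $f\in\mathbf{k}\{Y\}\setminus\mathbf{k}$, $w(f)$ is the maximum weight of the derivatives appearing in $f$; for $f\in\mathbf{k}$ put $w(f)=0$. For a finite set $A$, $\mathcal{W}(A)=\max\{w(f):f\in A\}$, with $\mathcal{W}(\varnothing)=0$. A ranking is a total order $<$ on $\Theta Y$ with $u<\theta u$ and $u<v\Rightarrow\theta u<\theta v$ for all $u,v\in\Theta Y$ and $\theta\in\Theta$, $\theta\neq\mathrm{id}$; it is a weighted ranking if $w(u)<w(v)$ implies $u<v$. For $f\in\mathbf{k}\{Y\}\setminus\mathbf{k}$: the leader $\mathrm{lead}(f)$ is the highest-ranked derivative in $f$; the initial $\mathrm{init}(f)$ is the leading coefficient of $f$ as a univariate polynomial in $\mathrm{lead}(f)$; the separant $\mathrm{sep}(f)$ is the initial of $\delta f$ for any $\delta\in\Delta$ (i.e. $\partial f/\partial\,\mathrm{lead}(f)$);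 $\mathrm{rank}(f)=\mathrm{lead}(f)^d$ with $d=\deg_{\mathrm{lead}(f)}(f)$, ranks being compared first by leader, then by $d$. For a set $A\subseteq\mathbf{k}\{Y\}\setminus\mathbf{k}$: $\mathfrak{L}(A)$ is its set of leaders, $S_A$ its set of separants, $H_A$ its set of initials and separants. $f$ is partially reduced with respect to $g$ if no proper derivative of $\mathrm{lead}(g)$ appears in $f$; it is reduced if moreover $\deg_{\mathrm{lead}(g)}(f)<\deg_{\mathrm{lead}(g)}(g)$; (partially) reduced with respect to a set means with respect to all its elements. $A$ is autoreduced if each element is reduced with respect to every other, and weak d-triangular if $\mathfrak{L}(A)$ is autoreduced (then distinct elements have distinct leaders, and $A_u$ denotes the element with leader $u$). $S^\infty$ is the multiplicative set generated by $S$ and $1$; $[A]$ is the differential ideal generated by $A$. For $A$ weak d-triangular, $\mathrm{pd\text{-}red}(f,A)$ (resp. $\mathrm{d\text{-}red}(f,A)$) is a polynomial $f_1$ partially reduced (resp. $f_2$ reduced) with respect to $A$, with $sf\equiv f_1 \bmod [A]$ for some $s\in S_A^\infty$ (resp. $hf\equiv f_2\bmod[A]$ for some $h\in H_A^\infty$), computed by fixed (standard) algorithms that never increase rank, hence never increase weight. If $u=\partial_1^{i_1}\cdots\partial_m^{i_m}y$, $v=\partial_1^{j_1}\cdots\partial_m^{j_m}y$ with the same $y\in Y$, then $\mathrm{lcd}(u,v)=\partial_1^{\max(i_1,j_1)}\cdots\partial_m^{\max(i_m,j_m)}y$. $\Delta(f,g)=0$ if $\mathrm{lead}(f),\mathrm{lead}(g)$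 are derivatives of different elements of $Y$; otherwise $\Delta(f,g)=\mathrm{sep}(g)\phi(f)-\mathrm{sep}(f)\psi(g)$, where $\phi,\psi\in\Theta$ satisfy $\phi(\mathrm{lead}(f))=\psi(\mathrm{lead}(g))=\mathrm{lcd}(\mathrm{lead}(f),\mathrm{lead}(g))$. The algorithm. $\textsf{Rosenfeld-Gröbner}(F,K)$ maintains a set $\mathcal{S}$ of 4-tuples $(G,D,A,H)$ of finite subsets of $\mathbf{k}\{Y\}$ ($A$ weak d-triangular), initially $\mathcal{S}=\{(F,\varnothing,\varnothing,K)\}$, and an output set $\mathcal{A}$, initially empty. While $\mathcal{S}\neq\varnothing$: remove some $(G,D,A,H)$ from $\mathcal{S}$. If $G\cup D=\varnothing$, replace $\mathcal{A}$ by $\mathcal{A}\cup\textsf{auto-partial-reduce}(A,H)$. Otherwise choose $p\in G\cup D$, put $\bar G=G\setminus\{p\}$, $\bar D=D\setminus\{p\}$, $\bar p=\mathrm{d\text{-}red}(p,A)$. If $\bar p=0$, add $(\bar G,\bar D,A,H)$ to $\mathcal{S}$. If $\bar p\in\mathbf{k}\setminus\{0\}$, add nothing. If $\bar p\notin\mathbf{k}$, put $\bar p_i=\bar p-\mathrm{init}(\bar p)\,\mathrm{rank}(\bar p)$, $\bar p_s=\deg_{\mathrm{lead}(\bar p)}(\bar p)\,\bar p-\mathrm{lead}(\bar p)\,\mathrm{sep}(\bar p)$ and add to $\mathcal{S}$ the three tuples $\textsf{update}(\bar G,\bar D,A,H,\bar p)$, $(\bar G\cup\{\bar p_s,\mathrm{sep}(\bar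 p)\},\bar D,A,H\cup\{\mathrm{init}(\bar p)\})$, $(\bar G\cup\{\bar p_i,\mathrm{init}(\bar p)\},\bar D,A,H)$. When $\mathcal{S}=\varnothing$, return $\mathcal{A}$. $\textsf{update}(G,D,A,H,p)$: with $u=\mathrm{lead}(p)$, $G_A=\{a\in A:\mathrm{lead}(a)\in\Theta u\}$, $\bar A=A\setminus G_A$, return $\bigl(G\cup G_A,\ (D\cup\{\Delta(p,a):a\in\bar A\})\setminus\{0\},\ \bar A\cup\{p\},\ H\cup\{\mathrm{sep}(p),\mathrm{init}(p)\}\bigr)$. $\textsf{auto-partial-reduce}(A,H)$: start with $B=\varnothing$; for $u\in\mathfrak{L}(A)$ in increasing order, let $b=\mathrm{pd\text{-}red}(A_u,B)$; if $\mathrm{rank}(b)=\mathrm{rank}(A_u)$ add $b$ to $B$, otherwise return $\varnothing$. Then let $K'=H_B\cup\{\mathrm{pd\text{-}red}(q,B):q\in H\setminus H_A\}$; return $\varnothing$ if $0\in K'$, otherwise return $\{(B,K')\}$. Antichain lengths. Let $\mathfrak{n}=\{1,\dots,n\}$. On $\mathbb{Z}_{\geqslant 0}^m\times\mathfrak{n}$ let $((i_1,\dots,i_m),k)\preccurlyeq((j_1,\dots,j_m),l)$ iff $k=l$ and $i_r\leqslant j_r$ for all $r$; the degree of $((i_1,\dots,i_m),k)$ is $i_1+\cdots+i_m$. An antichain sequence is a sequence $s_1,s_2,\dots$ of pairwise incomparable elements (all such sequences are finite). A function $f$ on $\mathbb{Z}_{>0}$ bounds its degree growth if $\deg(s_i)\leqslant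 f(i)$ for every term $s_i$. $\mathfrak{L}^n_{f,m}$ denotes the maximal length of an antichain sequence of $\mathbb{Z}_{\geqslant 0}^m\times\mathfrak{n}$ with degree growth bounded by $f$ (this maximum exists). *)

theory Defs
  imports "HOL-Library.Poly_Mapping" "HOL-Library.Product_Plus" "HOL-Library.Cardinality" "HOL.Hull"
begin

section \<open>Differential polynomials in two commuting derivations\<close>

text \<open>
  The operator \<open>\<partial>\<^sub>1\<^sup>i \<partial>\<^sub>2\<^sup>j\<close> is encoded as the exponent pair \<open>(i, j)\<close>; composition of operators is
  addition of pairs and the identity is \<open>0\<close>.  The derivative \<open>\<partial>\<^sub>1\<^sup>i \<partial>\<^sub>2\<^sup>j y\<close> is \<open>((i, j), y)\<close>.  The
  indeterminates are the elements of a finite type \<open>'y\<close>, so that \<open>n\<close> is \<open>CARD('y)\<close>.  An element of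
  \<open>k{Y}\<close> is a finitely supported map from monomials to coefficients.
\<close>

type_synonym theta = "nat \<times> nat"
type_synonym 'y derivative = "theta \<times> 'y"
type_synonym ('k, 'y) diffpoly = "('y derivative \<Rightarrow>\<^sub>0 nat) \<Rightarrow>\<^sub>0 'k"

definition act :: "theta \<Rightarrow> 'y derivative \<Rightarrow> 'y derivative" where
  "act \<theta> v = (\<theta> + fst v, snd v)"

definition derivation :: "('k::comm_ring_1 \<Rightarrow> 'k) \<Rightarrow> bool" where
  "derivation d \<longleftrightarrow> (\<forall>a b. d (a + b) = d a + d b) \<and> (\<forall>a b. d (a * b) = d a * b + a * d b)"

definition commuting_derivations :: "('k::comm_ring_1 \<Rightarrow> 'k) \<Rightarrow> ('k \<Rightarrow> 'k) \<Rightarrow> bool" where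
  "commuting_derivations d1 d2 \<longleftrightarrow> derivation d1 \<and> derivation d2 \<and> (\<forall>a. d1 (d2 a) = d2 (d1 a))"

definition Var :: "'y derivative \<Rightarrow> ('k::comm_ring_1, 'y) diffpoly" where
  "Var v = Poly_Mapping.single (Poly_Mapping.single v 1) 1"

definition ground :: "('k::comm_ring_1, 'y) diffpoly set" where
  "ground = range (Poly_Mapping.single 0)"

definition vars :: "('k::comm_ring_1, 'y) diffpoly \<Rightarrow> 'y derivative set" where
  "vars f = (\<Union>m\<in>Poly_Mapping.keys f. Poly_Mapping.keys m)"

definition deg_in :: "'y derivative \<Rightarrow> ('k::comm_ring_1, 'y) diffpoly \<Rightarrow> nat" where
  "deg_in v f = Max (insert 0 ((\<lambda>m. Poly_Mapping.lookup m v) ` Poly_Mapping.keys f))"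

text \<open>Coefficient of \<open>v\<^sup>e\<close> in \<open>f\<close>, viewed as a univariate polynomial in \<open>v\<close>.\<close>

definition coeff_in :: "'y derivative \<Rightarrow> nat \<Rightarrow> ('k::comm_ring_1, 'y) diffpoly \<Rightarrow> ('k, 'y) diffpoly" where
  "coeff_in v e f = (\<Sum>m\<in>{m \<in> Poly_Mapping.keys f. Poly_Mapping.lookup m v = e}.
     Poly_Mapping.single (m - Poly_Mapping.single v e) (Poly_Mapping.lookup f m))"

text \<open>
  Formal partial derivative with respect to \<open>v\<close>.  Subtraction of monomials is truncated, but it
  only truncates when the coefficient \<open>of_nat 0\<close> kills the term.
\<close>

definition partial :: "'y derivative \<Rightarrow> ('k::comm_ring_1, 'y) diffpoly \<Rightarrow> ('k, 'y) diffpoly" where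
  "partial v f = (\<Sum>m\<in>Poly_Mapping.keys f.
     Poly_Mapping.single (m - Poly_Mapping.single v 1)
       (of_nat (Poly_Mapping.lookup m v) * Poly_Mapping.lookup f m))"

text \<open>
  The unique derivation of \<open>k{Y}\<close> that extends \<open>d\<close> and sends each derivative \<open>v\<close> to \<open>act e v\<close>:
  apply \<open>d\<close> to the coefficients and use the chain rule for the derivatives occurring in \<open>f\<close>.
\<close>

definition extend_deriv ::
    "('k::comm_ring_1 \<Rightarrow> 'k) \<Rightarrow> theta \<Rightarrow> ('k, 'y) diffpoly \<Rightarrow> ('k, 'y) diffpoly" where
  "extend_deriv d e f = Poly_Mapping.map d f + (\<Sum>v\<in>vars f. partial v f * Var (act e v))"

lemma extend_deriv_Var:
  assumes "derivation d"
  shows "extend_deriv d e (Var v :: ('k::comm_ring_1, 'y) diffpoly) = Var (act e v)"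
proof -
  have "d (1 * 1) = d 1 * 1 + 1 * d 1"
    using assms unfolding derivation_def by blast
  moreover have "d (0 + 0) = d 0 + d 0"
    using assms unfolding derivation_def by blast
  ultimately have "d 1 = 0" "d 0 = 0" by simp_all
  then have "Poly_Mapping.map d (Var v :: ('k, 'y) diffpoly) = 0"
    by (simp add: Var_def when_def)
  moreover have "vars (Var v :: ('k, 'y) diffpoly) = {v}"
    by (simp add: vars_def Var_def)
  moreover have "partial v (Var v :: ('k, 'y) diffpoly) = 1"
    by (simp add: partial_def Var_def)
  ultimately show ?thesis by (simp add: extend_deriv_def)
qed

lemma extend_deriv_ground:
  assumes "derivation d"
  shows "extend_deriv d e (Poly_Mapping.single 0 a :: ('k::comm_ring_1, 'y) diffpoly) =
    Poly_Mapping.single 0 (d a)"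
proof -
  have "d (0 + 0) = d 0 + d 0"
    using assms unfolding derivation_def by blast
  then have "d 0 = 0" by simp
  moreover have "vars (Poly_Mapping.single 0 a :: ('k, 'y) diffpoly) = {}"
    by (simp add: vars_def)
  ultimately show ?thesis by (simp add: extend_deriv_def when_def)
qed

definition weight :: "nat \<Rightarrow> nat \<Rightarrow> 'y derivative \<Rightarrow> nat" where
  "weight c1 c2 v = c1 * fst (fst v) + c2 * snd (fst v)"

definition poly_weight :: "nat \<Rightarrow> nat \<Rightarrow> ('k::comm_ring_1, 'y) diffpoly \<Rightarrow> nat" where
  "poly_weight c1 c2 f = Max (insert 0 (weight c1 c2 ` vars f))"

definition set_weight :: "nat \<Rightarrow> nat \<Rightarrow> ('k::comm_ring_1, 'y) diffpoly set \<Rightarrow> nat" where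
  "set_weight c1 c2 A = Max (insert 0 (poly_weight c1 c2 ` A))"

definition ranking :: "('y derivative \<Rightarrow> 'y derivative \<Rightarrow> bool) \<Rightarrow> bool" where
  "ranking lt \<longleftrightarrow> irreflp lt \<and> transp lt \<and> totalp lt \<and>
     (\<forall>u \<theta>. \<theta> \<noteq> 0 \<longrightarrow> lt u (act \<theta> u)) \<and>
     (\<forall>u v \<theta>. \<theta> \<noteq> 0 \<longrightarrow> lt u v \<longrightarrow> lt (act \<theta> u) (act \<theta> v))"

definition weighted_ranking ::
    "nat \<Rightarrow> nat \<Rightarrow> ('y derivative \<Rightarrow> 'y derivative \<Rightarrow> bool) \<Rightarrow> bool" where
  "weighted_ranking c1 c2 lt \<longleftrightarrow> ranking lt \<and>
     (\<forall>u v. weight c1 c2 u < weight c1 c2 v \<longrightarrow> lt u v)"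

definition lcd :: "'y derivative \<Rightarrow> 'y derivative \<Rightarrow> 'y derivative" where
  "lcd u v = ((max (fst (fst u)) (fst (fst v)), max (snd (fst u)) (snd (fst v))), snd u)"

inductive_set mult_closure :: "'a::comm_ring_1 set \<Rightarrow> 'a set" for S where
  one: "1 \<in> mult_closure S"
| mult: "s \<in> S \<Longrightarrow> t \<in> mult_closure S \<Longrightarrow> s * t \<in> mult_closure S"


section \<open>Leaders, reduction and the Rosenfeld-Groebner algorithm\<close>

context
  fixes d1 d2 :: "'k::field_char_0 \<Rightarrow> 'k"
    and lt :: "'y derivative \<Rightarrow> 'y derivative \<Rightarrow> bool"
begin

definition apply_theta :: "theta \<Rightarrow> ('k, 'y) diffpoly \<Rightarrow> ('k, 'y) diffpoly" where
  "apply_theta \<theta> f = (extend_deriv d1 (1, 0) ^^ fst \<theta>) ((extend_deriv d2 (0, 1) ^^ snd \<theta>) f)"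

definition differential_ideal :: "('k, 'y) diffpoly set \<Rightarrow> bool" where
  "differential_ideal I \<longleftrightarrow> 0 \<in> I \<and> (\<forall>f\<in>I. \<forall>g\<in>I. f + g \<in> I) \<and> (\<forall>f\<in>I. \<forall>g. g * f \<in> I) \<and>
     (\<forall>f\<in>I. extend_deriv d1 (1, 0) f \<in> I \<and> extend_deriv d2 (0, 1) f \<in> I)"

definition diff_ideal_gen :: "('k, 'y) diffpoly set \<Rightarrow> ('k, 'y) diffpoly set" where
  "diff_ideal_gen A = differential_ideal hull A"

text \<open>Leaders, initials, separants and ranks are meaningful only for polynomials outside \<open>ground\<close>.\<close>

definition lead :: "('k, 'y) diffpoly \<Rightarrow> 'y derivative" where
  "lead f = (THE v. v \<in> vars f \<and> (\<forall>u\<in>vars f. u \<noteq> v \<longrightarrow> lt u v))"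

definition init :: "('k, 'y) diffpoly \<Rightarrow> ('k, 'y) diffpoly" where
  "init f = coeff_in (lead f) (deg_in (lead f) f) f"

definition sep :: "('k, 'y) diffpoly \<Rightarrow> ('k, 'y) diffpoly" where
  "sep f = partial (lead f) f"

definition rank :: "('k, 'y) diffpoly \<Rightarrow> ('k, 'y) diffpoly" where
  "rank f = Var (lead f) ^ deg_in (lead f) f"

text \<open>Comparison of ranks; elements of the ground field lie below all other polynomials.\<close>

definition rank_le :: "('k, 'y) diffpoly \<Rightarrow> ('k, 'y) diffpoly \<Rightarrow> bool" where
  "rank_le f g \<longleftrightarrow> f \<in> ground \<or>
     (f \<notin> ground \<and> g \<notin> ground \<and>
       (lt (lead f) (lead g) \<or>
        (lead f = lead g \<and> deg_in (lead f) f \<le> deg_in (lead g) g)))"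

definition separants :: "('k, 'y) diffpoly set \<Rightarrow> ('k, 'y) diffpoly set" where
  "separants A = sep ` A"

definition initials_separants :: "('k, 'y) diffpoly set \<Rightarrow> ('k, 'y) diffpoly set" where
  "initials_separants A = init ` A \<union> sep ` A"

definition partially_reduced :: "('k, 'y) diffpoly \<Rightarrow> ('k, 'y) diffpoly \<Rightarrow> bool" where
  "partially_reduced f g \<longleftrightarrow> (\<forall>\<theta>. \<theta> \<noteq> 0 \<longrightarrow> act \<theta> (lead g) \<notin> vars f)"

definition reduced :: "('k, 'y) diffpoly \<Rightarrow> ('k, 'y) diffpoly \<Rightarrow> bool" where
  "reduced f g \<longleftrightarrow> partially_reduced f g \<and> deg_in (lead g) f < deg_in (lead g) g"

definition autoreduced :: "('k, 'y) diffpoly set \<Rightarrow> bool" where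
  "autoreduced A \<longleftrightarrow> A \<inter> ground = {} \<and> (\<forall>f\<in>A. \<forall>g\<in>A. f \<noteq> g \<longrightarrow> reduced f g)"

text \<open>
  The injectivity clause says that distinct elements have distinct leaders; it is not visible in
  the set of leaders itself.
\<close>

definition weak_d_triangular :: "('k, 'y) diffpoly set \<Rightarrow> bool" where
  "weak_d_triangular A \<longleftrightarrow> A \<inter> ground = {} \<and> autoreduced (Var ` lead ` A) \<and> inj_on lead A"

text \<open>
  The reduction procedures are parameters: any functions that return a (partially) reduced
  pseudo-remainder of rank at most that of the input are admitted.
\<close>

definition pd_red_function ::
    "(('k, 'y) diffpoly \<Rightarrow> ('k, 'y) diffpoly set \<Rightarrow> ('k, 'y) diffpoly) \<Rightarrow> bool" where
  "pd_red_function pdred \<longleftrightarrow> (\<forall>f A. weak_d_triangular A \<longrightarrow>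
     (\<forall>g\<in>A. partially_reduced (pdred f A) g) \<and>
     (\<exists>s\<in>mult_closure (separants A). s * f - pdred f A \<in> diff_ideal_gen A) \<and>
     rank_le (pdred f A) f)"

definition d_red_function ::
    "(('k, 'y) diffpoly \<Rightarrow> ('k, 'y) diffpoly set \<Rightarrow> ('k, 'y) diffpoly) \<Rightarrow> bool" where
  "d_red_function dred \<longleftrightarrow> (\<forall>f A. weak_d_triangular A \<longrightarrow>
     (\<forall>g\<in>A. reduced (dred f A) g) \<and>
     (\<exists>h\<in>mult_closure (initials_separants A). h * f - dred f A \<in> diff_ideal_gen A) \<and>
     rank_le (dred f A) f)"

definition delta_poly :: "('k, 'y) diffpoly \<Rightarrow> ('k, 'y) diffpoly \<Rightarrow> ('k, 'y) diffpoly" where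
  "delta_poly f g =
     (if snd (lead f) \<noteq> snd (lead g) then 0
      else let l = lcd (lead f) (lead g);
               \<phi> = fst l - fst (lead f);
               \<psi> = fst l - fst (lead g)
           in sep g * apply_theta \<phi> f - sep f * apply_theta \<psi> g)"

type_synonym ('a, 'b) rg_tuple =
  "('a, 'b) diffpoly set \<times> ('a, 'b) diffpoly set \<times> ('a, 'b) diffpoly set \<times> ('a, 'b) diffpoly set"

type_synonym ('a, 'b) rg_output = "(('a, 'b) diffpoly set \<times> ('a, 'b) diffpoly set) set"

definition update ::
    "('k, 'y) diffpoly set \<Rightarrow> ('k, 'y) diffpoly set \<Rightarrow> ('k, 'y) diffpoly set \<Rightarrow>
     ('k, 'y) diffpoly set \<Rightarrow> ('k, 'y) diffpoly \<Rightarrow> ('k, 'y) rg_tuple" where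
  "update G D A H p =
     (let u = lead p;
          GA = {a \<in> A. lead a \<in> range (\<lambda>\<theta>. act \<theta> u)};
          A' = A - GA
      in (G \<union> GA, (D \<union> delta_poly p ` A') - {0}, A' \<union> {p}, H \<union> {sep p, init p}))"

context
  fixes dred pdred :: "('k, 'y) diffpoly \<Rightarrow> ('k, 'y) diffpoly set \<Rightarrow> ('k, 'y) diffpoly"
begin

text \<open>
  The loop of the auto-partial-reduction over a list of leaders, starting from \<open>B\<close>; \<open>None\<close>
  stands for an early return of the empty set.
\<close>

fun apr_loop :: "('k, 'y) diffpoly set \<Rightarrow> 'y derivative list \<Rightarrow> ('k, 'y) diffpoly set \<Rightarrow>
    ('k, 'y) diffpoly set option" where
  "apr_loop A [] B = Some B"
| "apr_loop A (u # us) B =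
     (let a = (THE a. a \<in> A \<and> lead a = u); b = pdred a B
      in if b \<notin> ground \<and> rank b = rank a then apr_loop A us (insert b B) else None)"

definition auto_partial_reduce ::
    "('k, 'y) diffpoly set \<Rightarrow> ('k, 'y) diffpoly set \<Rightarrow> ('k, 'y) rg_output" where
  "auto_partial_reduce A H =
     (case apr_loop A (THE us. sorted_wrt lt us \<and> set us = lead ` A) {} of
        None \<Rightarrow> {}
      | Some B \<Rightarrow>
          (let K' = initials_separants B \<union> (\<lambda>q. pdred q B) ` (H - initials_separants A)
           in if 0 \<in> K' then {} else {(B, K')}))"

definition rg_successors ::
    "('k, 'y) diffpoly set \<Rightarrow> ('k, 'y) diffpoly set \<Rightarrow> ('k, 'y) diffpoly set \<Rightarrow>
     ('k, 'y) diffpoly set \<Rightarrow> ('k, 'y) diffpoly \<Rightarrow> ('k, 'y) rg_tuple set" where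
  "rg_successors G D A H q =
     (if q = 0 then {(G, D, A, H)}
      else if q \<in> ground then {}
      else let qi = q - init q * rank q;
               qs = of_nat (deg_in (lead q) q) * q - Var (lead q) * sep q
           in {update G D A H q,
               (G \<union> {qs, sep q}, D, A, H \<union> {init q}),
               (G \<union> {qi, init q}, D, A, H)})"

text \<open>
  One iteration of the main loop on states \<open>(\<S>, \<A>)\<close>.  The choice of the tuple and of the
  polynomial \<open>p\<close> is nondeterministic.
\<close>

inductive rg_step ::
    "('k, 'y) rg_tuple set \<times> ('k, 'y) rg_output \<Rightarrow>
     ('k, 'y) rg_tuple set \<times> ('k, 'y) rg_output \<Rightarrow> bool" where
  finish: "\<lbrakk>(G, D, A, H) \<in> S; G \<union> D = {}\<rbrakk> \<Longrightarrow>
    rg_step (S, Out) (S - {(G, D, A, H)}, Out \<union> auto_partial_reduce A H)"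
| branch: "\<lbrakk>(G, D, A, H) \<in> S; p \<in> G \<union> D\<rbrakk> \<Longrightarrow>
    rg_step (S, Out)
      ((S - {(G, D, A, H)}) \<union> rg_successors (G - {p}) (D - {p}) A H (dred p A), Out)"

text \<open>\<open>Out\<close> is the value returned by some run of the algorithm on input \<open>(F, K)\<close>.\<close>

definition rosenfeld_groebner ::
    "('k, 'y) diffpoly set \<Rightarrow> ('k, 'y) diffpoly set \<Rightarrow> ('k, 'y) rg_output \<Rightarrow> bool" where
  "rosenfeld_groebner F K Out \<longleftrightarrow> rg_step\<^sup>*\<^sup>* ({(F, {}, {}, K)}, {}) ({}, Out)"

end

end


section \<open>Antichain sequences and the bounding sequence\<close>

definition prec_eq :: "(nat \<times> nat) \<times> nat \<Rightarrow> (nat \<times> nat) \<times> nat \<Rightarrow> bool" where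
  "prec_eq s t \<longleftrightarrow> snd s = snd t \<and> fst (fst s) \<le> fst (fst t) \<and> snd (fst s) \<le> snd (fst t)"

definition antichain_sequence :: "nat \<Rightarrow> ((nat \<times> nat) \<times> nat) list \<Rightarrow> bool" where
  "antichain_sequence n ss \<longleftrightarrow> (\<forall>s\<in>set ss. snd s \<in> {1..n}) \<and>
     (\<forall>i<length ss. \<forall>j<length ss. i \<noteq> j \<longrightarrow> \<not> prec_eq (ss ! i) (ss ! j))"

text \<open>
  Terms of a sequence are numbered from 1 and list positions from 0.  The bound is integer-valued
  because the bounding sequence below can become negative.
\<close>

definition degree_growth_bounded :: "(nat \<Rightarrow> int) \<Rightarrow> ((nat \<times> nat) \<times> nat) list \<Rightarrow> bool" where
  "degree_growth_bounded f ss \<longleftrightarrow>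
     (\<forall>i<length ss. int (fst (fst (ss ! i)) + snd (fst (ss ! i))) \<le> f (i + 1))"

definition max_antichain_length :: "nat \<Rightarrow> (nat \<Rightarrow> int) \<Rightarrow> nat" where
  "max_antichain_length n f =
     Max {length ss | ss. antichain_sequence n ss \<and> degree_growth_bounded f ss}"

fun bound_seq :: "nat \<Rightarrow> nat \<Rightarrow> nat \<Rightarrow> int" where
  "bound_seq n h 0 = 0"
| "bound_seq n h (Suc 0) = int h"
| "bound_seq n h (Suc (Suc 0)) = int h"
| "bound_seq n h (Suc (Suc (Suc k))) =
     (if Suc (Suc (Suc k)) \<le> n + 1
      then bound_seq n h (Suc (Suc k)) + bound_seq n h (Suc k)
      else bound_seq n h (Suc (Suc k)) + bound_seq n h (Suc k) - 1)"

end

theory Submission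
  imports Defs
begin

text \<open>
  Along a branch of the computation record an antichain of leaders, in order of appearance: the
  leader of a new polynomial joins if it is comparable to no member. No later leader is a proper
  derivative of a member, since the new polynomials are reduced. A weight that exceeds the present
  bound comes from the least common derivative of two incomparable leaders, so it is at most the
  sum of the weights of two members; this gives the Fibonacci recursion. In two variables that sum
  is attained only by a pair \<open>\<partial>\<^sub>1\<^sup>a y\<close>,
  \<open>\<partial>\<^sub>2\<^sup>b y\<close>, and an antichain has at most one such pair for each
  \<open>y\<close>. When the last of the \<open>n\<close> indeterminates receives its pair, every
  derivative of the extremal weight is reducible. So at most \<open>n - 1\<close> steps attain the
  sum and all others lose at least one; the bound is largest when the lossless steps come first,
  and this is the given sequence. Each member of the antichain obeys the bound at its position, so
  their number is at most \<open>L\<close>.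
\<close>

section \<open>The bounding sequence\<close>

text \<open>From index 3 on, a term exceeds its predecessor by the term before that, minus at most
  1. This is nonnegative because all earlier terms from index 1 on are at least 1.\<close>

lemma bound_seq_pos_mono:
  assumes "h > 0"
  shows "1 \<le> bound_seq n h (Suc k) \<and> bound_seq n h (Suc k) \<le> bound_seq n h (Suc (Suc k))"
proof (induction k)
  case 0
  then show ?case using assms by simp
next
  case (Suc k)
  then show ?case by simp
qed

lemma bound_seq_mono:
  assumes "h > 0" "i \<le> j"
  shows "bound_seq n h i \<le> bound_seq n h j"
proof (rule lift_Suc_mono_le[OF _ \<open>i \<le> j\<close>])
  show "bound_seq n h k \<le> bound_seq n h (Suc k)" for k
  proof (cases k)
    case 0
    then show ?thesis by simp
  next
    case (Suc l)
    then show ?thesis using bound_seq_pos_mono[OF \<open>h > 0\<close>] by blast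
  qed
qed

text \<open>A larger \<open>n\<close> only postpones the first subtraction of 1.\<close>

lemma bound_seq_mono_n:
  assumes "n \<le> n'"
  shows "bound_seq n h k \<le> bound_seq n' h k"
  using assms
proof (induction n h k rule: bound_seq.induct)
  case (4 n h k)
  have "bound_seq n h (Suc (Suc k)) \<le> bound_seq n' h (Suc (Suc k))"
    and "bound_seq n h (Suc k) \<le> bound_seq n' h (Suc k)"
    using 4 by (cases "Suc (Suc (Suc k)) \<le> n + 1"; simp)+
  then show ?case using \<open>n \<le> n'\<close> by auto
qed auto

text \<open>Up to index \<open>n + 1\<close> the recursion is purely Fibonacci, so the zero initial
  values persist. Beyond it the terms can become negative.\<close>

lemma bound_seq_zero: "k \<le> n + 1 \<Longrightarrow> bound_seq n 0 k = 0"
  by (induction n "0::nat" k rule: bound_seq.induct) auto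

lemma bound_seq_step: "bound_seq n h (k + 2) + bound_seq n h (k + 1) - 1 \<le> bound_seq n h (k + 3)"
  by (simp add: numeral_3_eq_3)

text \<open>At index \<open>n + 2\<close> the sequence for \<open>n\<close> subtracts 1 for the
  first time and that for \<open>Suc n\<close> does not yet; the gain is passed on to all later
  terms. \<open>n > 0\<close> makes this index at least 3, where the recursion applies.\<close>

lemma bound_seq_strict_n:
  assumes "n > 0" "n + 2 \<le> k"
  shows "bound_seq n h k + 1 \<le> bound_seq (Suc n) h k"
  using \<open>n + 2 \<le> k\<close>
proof (induction k rule: dec_induct)
  case base
  obtain l where l: "n + 2 = Suc (Suc (Suc l))" using \<open>n > 0\<close> by (cases n) auto
  have "bound_seq n h (Suc (Suc l)) \<le> bound_seq (Suc n) h (Suc (Suc l))"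
    "bound_seq n h (Suc l) \<le> bound_seq (Suc n) h (Suc l)"
    by (simp_all only: bound_seq_mono_n)
  moreover have "\<not> Suc (Suc (Suc l)) \<le> n + 1" "Suc (Suc (Suc l)) \<le> Suc n + 1" using l by linarith+
  ultimately show ?case unfolding l bound_seq.simps by (simp only: if_True if_False)
next
  case (step m)
  obtain l where l: "m = Suc (Suc l)" using step.hyps \<open>n > 0\<close> by (metis add_2_eq_Suc' le_Suc_ex plus_nat.simps(2))
  have *: "bound_seq n h (Suc l) \<le> bound_seq (Suc n) h (Suc l)"
    by (rule bound_seq_mono_n) simp
  have "\<not> Suc m \<le> n + 1" using step.hyps by linarith
  then have "bound_seq n h (Suc m) = bound_seq n h m + bound_seq n h (Suc l) - 1"
    unfolding l bound_seq.simps by (simp only: if_False)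
  moreover have "bound_seq (Suc n) h m + bound_seq (Suc n) h (Suc l) - 1 \<le> bound_seq (Suc n) h (Suc m)"
    unfolding l bound_seq.simps by simp
  ultimately show ?case using step.IH * by linarith
qed

text \<open>A late lossless step yields no more than one extra lossless step at the start. Either
  \<open>k + 3\<close> is still in the Fibonacci range of \<open>Suc n\<close>, or the 1 subtracted
  there has been gained before, by \<open>bound_seq_strict_n\<close>.\<close>

lemma bound_seq_lossless:
  assumes "n > 0"
  shows "bound_seq n h (k + 2) + bound_seq n h (k + 1) \<le> bound_seq (Suc n) h (k + 3)"
proof -
  have eqs: "k + 3 = Suc (Suc (Suc k))" "k + 2 = Suc (Suc k)" "k + 1 = Suc k" by simp_all
  have le: "bound_seq n h j \<le> bound_seq (Suc n) h j" for j
    by (rule bound_seq_mono_n) simp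
  show ?thesis
  proof (cases "k + 3 \<le> Suc n + 1")
    case True
    then show ?thesis using le[of "k + 1"] le[of "k + 2"] by (simp add: eqs)
  next
    case False
    then have "bound_seq n h (k + 2) + 1 \<le> bound_seq (Suc n) h (k + 2)"
      using bound_seq_strict_n[OF assms, where h = h and k = "k + 2"] by linarith
    then show ?thesis using False le[of "k + 1"] by (simp add: eqs)
  qed
qed

text \<open>
  The sequence that bounds the weights along a branch on which \<open>r\<close> indeterminates are saturated.
  For \<open>h = 0\<close> the recursion would become negative, although all weights stay \<open>0\<close>.
\<close>

definition growth :: "nat \<Rightarrow> nat \<Rightarrow> nat \<Rightarrow> nat \<Rightarrow> int" where
  "growth n h r k = (if h = 0 then 0 else bound_seq (min (r + 1) n) h k)"

lemma growth_one: "growth n h r 1 = int h"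
  by (simp add: growth_def)

lemma growth_mono: "r \<le> r' \<Longrightarrow> i \<le> j \<Longrightarrow> growth n h r i \<le> growth n h r' j"
proof (cases "h = 0")
  case False
  assume "r \<le> r'" "i \<le> j"
  then have "bound_seq (min (r + 1) n) h i \<le> bound_seq (min (r' + 1) n) h i"
    by (intro bound_seq_mono_n) simp
  also have "\<dots> \<le> bound_seq (min (r' + 1) n) h j"
    using False \<open>i \<le> j\<close> by (intro bound_seq_mono) simp_all
  finally show ?thesis using False by (simp add: growth_def)
qed (simp add: growth_def)

lemma growth_step: "growth n h r (k + 2) + growth n h r (k + 1) - 1 \<le> growth n h r (k + 3)"
  using bound_seq_step by (simp add: growth_def)

text \<open>\<open>bound_seq (r + 1)\<close> has exactly \<open>r\<close> lossless steps, one for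
  each saturated indeterminate. The hypothesis keeps the cap \<open>min\<close> inactive on both
  sides.\<close>

lemma growth_lossless:
  "r + 1 < n \<Longrightarrow> growth n h r (k + 2) + growth n h r (k + 1) \<le> growth n h (Suc r) (k + 3)"
  using bound_seq_lossless[of "r + 1" h k] by (simp add: growth_def min_absorb1)

lemma growth_le_bound_seq: "h > 0 \<Longrightarrow> growth n h r k \<le> bound_seq n h k"
  by (simp add: growth_def bound_seq_mono_n)


section \<open>Lengths of antichain sequences\<close>

text \<open>Any other element has first coordinate below \<open>a\<close> or second coordinate below
  \<open>b\<close>. Each coordinate is injective on an antichain, so there are at most
  \<open>a + b\<close> others.\<close>

lemma card_antichain_le:
  fixes X :: "(nat \<times> nat) set"
  assumes "finite X" "(a, b) \<in> X"
    and anti: "\<And>s t. s \<in> X \<Longrightarrow> t \<in> X \<Longrightarrow> s \<noteq> t \<Longrightarrow> \<not> (fst s \<le> fst t \<and> snd s \<le> snd t)"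
  shows "card X \<le> a + b + 1"
proof -
  let ?X1 = "{s \<in> X. fst s < a}" and ?X2 = "{s \<in> X. snd s < b}"
  have "X \<subseteq> {(a, b)} \<union> (?X1 \<union> ?X2)"
    using anti[OF assms(2)] by force
  then have "card X \<le> card ({(a, b)} \<union> (?X1 \<union> ?X2))"
    using assms(1) by (intro card_mono) auto
  also have "\<dots> \<le> card {(a, b)} + (card ?X1 + card ?X2)"
    by (meson card_Un_le add_left_mono le_trans)
  also have "card ?X1 \<le> a"
  proof -
    have "inj_on fst ?X1"
    proof (rule inj_onI, rule ccontr)
      fix s t assume "s \<in> ?X1" "t \<in> ?X1" "fst s = fst t" "s \<noteq> t"
      then show False using anti[of s t] anti[of t s] by auto
    qed
    then have "card ?X1 = card (fst ` ?X1)" by (simp add: card_image)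
    also have "\<dots> \<le> card {..<a}" by (intro card_mono) auto
    finally show ?thesis by simp
  qed
  also have "card ?X2 \<le> b"
  proof -
    have "inj_on snd ?X2"
    proof (rule inj_onI, rule ccontr)
      fix s t assume "s \<in> ?X2" "t \<in> ?X2" "snd s = snd t" "s \<noteq> t"
      then show False using anti[of s t] anti[of t s] by auto
    qed
    then have "card ?X2 = card (snd ` ?X2)" by (simp add: card_image)
    also have "\<dots> \<le> card {..<b}" by (intro card_mono) auto
    finally show ?thesis by simp
  qed
  finally show ?thesis by simp
qed

section \<open>Antichain sequences with several colours\<close>

lemma antichain_sequence_take: "antichain_sequence n ss \<Longrightarrow> antichain_sequence n (take t ss)"
  unfolding antichain_sequence_def by (auto dest: in_set_takeD)

lemma degree_growth_bounded_take:
  "degree_growth_bounded f ss \<Longrightarrow> degree_growth_bounded f (take t ss)"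
  unfolding degree_growth_bounded_def by auto

lemma antichain_sequence_distinct: "antichain_sequence n ss \<Longrightarrow> distinct ss"
  unfolding distinct_conv_nth
proof (intro allI impI notI)
  fix i j assume "antichain_sequence n ss" "i < length ss" "j < length ss" "i \<noteq> j" "ss ! i = ss ! j"
  moreover from this have "prec_eq (ss ! i) (ss ! j)" by (simp add: prec_eq_def)
  ultimately show False unfolding antichain_sequence_def by blast
qed

text \<open>The exponent pairs of one colour form an antichain in the plane, so a single element of
  small degree limits its whole colour class.\<close>

lemma antichain_colour_card:
  assumes "antichain_sequence n ss" "degree_growth_bounded f ss" "i < length ss"
  shows "int (card {s \<in> set ss. snd s = snd (ss ! i)}) \<le> f (i + 1) + 1"
proof -
  let ?C = "{s \<in> set ss. snd s = snd (ss ! i)}"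
  obtain a b x where s: "ss ! i = ((a, b), x)" by (metis surj_pair)
  have inj: "inj_on fst ?C" by (auto intro!: inj_onI prod_eqI)
  have "card (fst ` ?C) \<le> a + b + 1"
  proof (rule card_antichain_le)
    show "(a, b) \<in> fst ` ?C"
      using s assms(3) nth_mem by (force simp: image_iff)
    show "\<not> (fst s \<le> fst t \<and> snd s \<le> snd t)" if "s \<in> fst ` ?C" "t \<in> fst ` ?C" "s \<noteq> t" for s t
    proof -
      obtain p q where pq: "p \<in> ?C" "q \<in> ?C" "s = fst p" "t = fst q" using \<open>s \<in> _\<close> \<open>t \<in> _\<close> by blast
      then obtain j k where "j < length ss" "k < length ss" "p = ss ! j" "q = ss ! k"
        by (auto simp: in_set_conv_nth)
      moreover from this have "j \<noteq> k" using pq \<open>s \<noteq> t\<close> by auto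
      ultimately have "\<not> prec_eq p q" using assms(1) by (auto simp: antichain_sequence_def)
      then show ?thesis using pq by (simp add: prec_eq_def)
    qed
  qed simp
  then have "card ?C \<le> a + b + 1" using inj by (simp add: card_image)
  moreover have "int (a + b) \<le> f (i + 1)"
    using assms(2,3) s unfolding degree_growth_bounded_def by fastforce
  ultimately show ?thesis by linarith
qed

text \<open>
  Induction on the number of colours: every colour has an element among the first \<open>B + 1\<close>
  positions, where \<open>B\<close> bounds the length of sequences with one colour less.
\<close>

lemma antichain_length_bounded_colours:
  "\<exists>B. \<forall>ss. antichain_sequence n ss \<longrightarrow> degree_growth_bounded f ss \<longrightarrow>
     card (snd ` set ss) \<le> c \<longrightarrow> length ss \<le> B"
proof (induction c)
  case 0
  then show ?case by auto
next
  case (Suc c)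
  then obtain B where B: "\<And>ss. antichain_sequence n ss \<Longrightarrow> degree_growth_bounded f ss \<Longrightarrow>
      card (snd ` set ss) \<le> c \<Longrightarrow> length ss \<le> B" by blast
  \<comment> \<open>\<open>M\<close> bounds the size of every colour class with a member among the
    first \<open>B + 1\<close> positions.\<close>
  define M where "M = nat (Max (f ` {..B + 1}) + 1)"
  have "length ss \<le> max B (Suc c * M)"
    if ss: "antichain_sequence n ss" "degree_growth_bounded f ss" "card (snd ` set ss) \<le> Suc c" for ss
  proof (cases "card (snd ` set (take (B + 1) ss)) \<le> c")
    case True
    \<comment> \<open>A prefix cut at \<open>B + 1\<close> that has at most \<open>B\<close> terms
      is the whole sequence.\<close>
    then have "length (take (B + 1) ss) \<le> B"
      using ss antichain_sequence_take degree_growth_bounded_take B by blast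
    then show ?thesis by simp
  next
    case False
    \<comment> \<open>The prefix has more than \<open>c\<close> colours and \<open>ss\<close> at
      most \<open>Suc c\<close>, so no colour is missing from the prefix.\<close>
    have colours: "snd ` set (take (B + 1) ss) = snd ` set ss"
    proof (rule card_subset_eq)
      show sub: "snd ` set (take (B + 1) ss) \<subseteq> snd ` set ss"
        by (intro image_mono set_take_subset)
      show "card (snd ` set (take (B + 1) ss)) = card (snd ` set ss)"
        using False ss(3) card_mono[OF _ sub] by simp
    qed simp
    have col: "card {s \<in> set ss. snd s = x} \<le> M" if "x \<in> snd ` set ss" for x
    proof -
      have "x \<in> snd ` set (take (B + 1) ss)"
        unfolding colours by (rule that)
      then obtain s where "s \<in> set (take (B + 1) ss)" "x = snd s"
        by (rule imageE)
      then obtain i where i: "i < length ss" "i < B + 1" "x = snd (ss ! i)"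
        by (auto simp: in_set_conv_nth)
      have "int (card {s \<in> set ss. snd s = x}) \<le> f (i + 1) + 1"
        using antichain_colour_card[OF ss(1,2) i(1)] i(3) by simp
      also have "f (i + 1) \<le> Max (f ` {..B + 1})" using i(2) by (intro Max_ge) auto
      finally show ?thesis unfolding M_def by linarith
    qed
    have "set ss = (\<Union>x\<in>snd ` set ss. {s \<in> set ss. snd s = x})" by auto
    then have "length ss = card (\<Union>x\<in>snd ` set ss. {s \<in> set ss. snd s = x})"
      using antichain_sequence_distinct[OF ss(1)] by (metis distinct_card)
    also have "\<dots> \<le> (\<Sum>x\<in>snd ` set ss. card {s \<in> set ss. snd s = x})"
      by (rule card_UN_le) simp
    also have "\<dots> \<le> card (snd ` set ss) * M"
      using sum_bounded_above[of "snd ` set ss" "\<lambda>x. card {s \<in> set ss. snd s = x}" M] col by simp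
    also have "\<dots> \<le> Suc c * M" using ss(3) by (rule mult_le_mono1)
    finally show ?thesis by simp
  qed
  then show ?case by blast
qed

text \<open>Only \<open>n\<close> colours exist, so the bound by the number of colours covers all
  sequences. This makes the \<open>Max\<close> in \<open>max_antichain_length\<close> a genuine
  upper bound.\<close>

lemma finite_antichain_lengths:
  "finite {length ss | ss. antichain_sequence n ss \<and> degree_growth_bounded f ss}"
proof -
  obtain B where B: "\<And>ss. antichain_sequence n ss \<Longrightarrow> degree_growth_bounded f ss \<Longrightarrow>
      card (snd ` set ss) \<le> n \<Longrightarrow> length ss \<le> B"
    using antichain_length_bounded_colours by metis
  have "card (snd ` set ss) \<le> n" if "antichain_sequence n ss" for ss
  proof -
    have "card (snd ` set ss) \<le> card {1..n}"
      using that by (intro card_mono) (auto simp: antichain_sequence_def)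
    then show ?thesis by simp
  qed
  with B have "{length ss | ss. antichain_sequence n ss \<and> degree_growth_bounded f ss} \<subseteq> {..B}" by auto
  then show ?thesis by (rule finite_subset) simp
qed

lemma length_le_max_antichain_length:
  "antichain_sequence n ss \<Longrightarrow> degree_growth_bounded f ss \<Longrightarrow> length ss \<le> max_antichain_length n f"
  unfolding max_antichain_length_def by (rule Max_ge[OF finite_antichain_lengths]) blast

text \<open>The first \<open>n + 1\<close> positions admit only degree 0, so a longer sequence would
  need \<open>n + 1\<close> distinct colours. In the final bound this keeps the index where
  \<open>bound_seq n 0\<close> vanishes.\<close>

lemma max_antichain_length_zero: "max_antichain_length n (bound_seq n 0) \<le> n"
proof -
  have "length ss \<le> n" if ss: "antichain_sequence n ss" "degree_growth_bounded (bound_seq n 0) ss" for ss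
  proof (rule ccontr)
    assume long: "\<not> length ss \<le> n"
    have zero: "fst (ss ! i) = (0, 0)" if "i \<le> n" for i
    proof -
      have "int (fst (fst (ss ! i)) + snd (fst (ss ! i))) \<le> bound_seq n 0 (i + 1)"
        using ss(2) that long unfolding degree_growth_bounded_def by simp
      also have "\<dots> = 0" using that by (intro bound_seq_zero) simp
      finally have "int (fst (fst (ss ! i)) + snd (fst (ss ! i))) \<le> 0" .
      then show ?thesis by (simp add: prod_eq_iff)
    qed
    have "inj_on (\<lambda>i. snd (ss ! i)) {..n}"
    proof (rule inj_onI, rule ccontr)
      fix i j assume ij: "i \<in> {..n}" "j \<in> {..n}" "snd (ss ! i) = snd (ss ! j)" "i \<noteq> j"
      then have "prec_eq (ss ! i) (ss ! j)" using zero by (simp add: prec_eq_def)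
      moreover have "i < length ss" "j < length ss" using ij long by auto
      ultimately show False using ss(1) \<open>i \<noteq> j\<close> by (auto simp: antichain_sequence_def)
    qed
    then have "card {..n} = card ((\<lambda>i. snd (ss ! i)) ` {..n})" by (simp add: card_image)
    also have "\<dots> \<le> card {1..n}"
      using ss(1) long by (intro card_mono) (auto simp: antichain_sequence_def)
    finally show False by simp
  qed
  \<comment> \<open>The empty sequence makes the set of lengths nonempty, as a bound on
    \<open>Max\<close> requires.\<close>
  moreover have "antichain_sequence n []" "degree_growth_bounded (bound_seq n 0) []"
    by (simp_all add: antichain_sequence_def degree_growth_bounded_def)
  ultimately show ?thesis
    unfolding max_antichain_length_def by (intro Max.boundedI finite_antichain_lengths) blast+
qed


section \<open>Derivatives occurring in differential polynomials\<close>

lemma keys_minus_nat_subset: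
  "Poly_Mapping.keys (m - m' :: 'a \<Rightarrow>\<^sub>0 nat) \<subseteq> Poly_Mapping.keys m"
  by (auto simp: in_keys_iff lookup_minus)

lemma finite_vars [simp]: "finite (vars f)"
  by (simp add: vars_def)

lemma vars_subsetI: "Poly_Mapping.keys f \<subseteq> Poly_Mapping.keys g \<Longrightarrow> vars f \<subseteq> vars g"
  by (auto simp: vars_def)

lemma vars_zero [simp]: "vars 0 = {}"
  by (simp add: vars_def)

lemma vars_one [simp]: "vars 1 = {}"
  by (simp add: vars_def)

lemma vars_single: "vars (Poly_Mapping.single m a) \<subseteq> Poly_Mapping.keys m"
  by (simp add: vars_def)

lemma vars_Var [simp]: "vars (Var v) = {v}"
  by (simp add: vars_def Var_def)

lemma vars_add: "vars (f + g) \<subseteq> vars f \<union> vars g"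
  using keys_add[of f g] by (auto simp: vars_def)

lemma vars_diff: "vars (f - g) \<subseteq> vars f \<union> vars g"
  using keys_diff[of f g] by (auto simp: vars_def)

lemma vars_mult: "vars (f * g) \<subseteq> vars f \<union> vars g"
proof
  fix v assume "v \<in> vars (f * g)"
  then obtain m where "m \<in> Poly_Mapping.keys (f * g)" and v: "v \<in> Poly_Mapping.keys m"
    by (auto simp: vars_def)
  then obtain m1 m2 where "m = m1 + m2" "m1 \<in> Poly_Mapping.keys f" "m2 \<in> Poly_Mapping.keys g"
    using keys_mult[of f g] by blast
  then show "v \<in> vars f \<union> vars g"
    using v keys_add[of m1 m2] by (auto simp: vars_def)
qed

lemma vars_sum: "vars (sum f I) \<subseteq> (\<Union>i\<in>I. vars (f i))"
  using keys_sum[of f I] by (fastforce simp: vars_def)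

lemma vars_power: "vars (f ^ k) \<subseteq> vars f"
proof (induction k)
  case (Suc k)
  then show ?case using vars_mult[of f "f ^ k"] by auto
qed simp

lemma vars_of_nat [simp]: "vars (of_nat k) = {}"
proof (induction k)
  case (Suc k)
  then show ?case using vars_add[of 1 "of_nat k"] by auto
qed simp

text \<open>The common core of \<open>partial\<close> and \<open>coeff_in\<close>: truncated
  subtraction of monomials introduces no new derivative.\<close>

lemma vars_sum_single_subset:
  fixes f :: "('k::comm_ring_1, 'y) diffpoly"
  assumes "M \<subseteq> Poly_Mapping.keys f"
  shows "vars (\<Sum>m\<in>M. Poly_Mapping.single (m - g m :: 'y derivative \<Rightarrow>\<^sub>0 nat) (c m)
    :: ('k, 'y) diffpoly) \<subseteq> vars f"
proof -
  have "vars (Poly_Mapping.single (m - g m) (c m) :: ('k, 'y) diffpoly) \<subseteq> vars f" if "m \<in> M" for m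
  proof -
    have "vars (Poly_Mapping.single (m - g m) (c m) :: ('k, 'y) diffpoly) \<subseteq> Poly_Mapping.keys m"
      using vars_single keys_minus_nat_subset by (rule subset_trans)
    also have "\<dots> \<subseteq> vars f" using that assms by (auto simp: vars_def)
    finally show ?thesis .
  qed
  then show ?thesis by (intro subset_trans[OF vars_sum] UN_least)
qed

lemma vars_partial: "vars (partial v f) \<subseteq> vars f"
  unfolding partial_def by (rule vars_sum_single_subset) simp

lemma vars_coeff_in: "vars (coeff_in v e f) \<subseteq> vars f"
  unfolding coeff_in_def by (rule vars_sum_single_subset) simp

lemma vars_extend_deriv: "vars (extend_deriv d e f) \<subseteq> vars f \<union> act e ` vars f"
proof -
  have 1: "vars (Poly_Mapping.map d f) \<subseteq> vars f"
    by (rule vars_subsetI) (auto simp: in_keys_iff map.rep_eq when_def)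
  have "vars (partial v f * Var (act e v)) \<subseteq> vars f \<union> act e ` vars f" if "v \<in> vars f" for v
    using vars_mult[of "partial v f" "Var (act e v)"] vars_partial[of v f] that by auto
  then have "vars (\<Sum>v\<in>vars f. partial v f * Var (act e v)) \<subseteq> vars f \<union> act e ` vars f"
    by (intro subset_trans[OF vars_sum] UN_least)
  with 1 show ?thesis
    unfolding extend_deriv_def by (intro subset_trans[OF vars_add]) blast
qed

lemma vars_eq_empty_iff: "vars f = {} \<longleftrightarrow> f \<in> ground"
proof
  assume "vars f = {}"
  then have "m = 0" if "m \<in> Poly_Mapping.keys f" for m
    using that by (auto simp: vars_def)
  then have "f = Poly_Mapping.single 0 (Poly_Mapping.lookup f 0)"
    by (intro poly_mapping_eqI) (auto simp: lookup_single when_def in_keys_iff)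
  then show "f \<in> ground" unfolding ground_def by blast
qed (auto simp: ground_def vars_def split: if_splits)

lemma Var_not_ground [simp]: "Var v \<notin> ground"
  by (simp flip: vars_eq_empty_iff)

lemma deg_in_Var: "deg_in v (Var u :: ('k::comm_ring_1, 'y) diffpoly) = (if v = u then 1 else 0)"
  by (simp add: deg_in_def Var_def lookup_single when_def)

lemma deg_in_pos: "v \<in> vars f \<Longrightarrow> deg_in v f > 0"
  unfolding deg_in_def vars_def by (subst Max_gr_iff) (auto simp: in_keys_iff)

lemma Var_power: "(Var v :: ('k::comm_ring_1, 'y) diffpoly) ^ k = Poly_Mapping.single (Poly_Mapping.single v k) 1"
  by (induction k) (simp_all add: Var_def mult_single flip: single_add)

text \<open>A positive power shows its variable in the support of its monomial; \<open>i > 0\<close>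
  excludes the common power 1. This recovers the leader from the rank.\<close>

lemma Var_power_inject:
  assumes "(Var u :: ('k::comm_ring_1, 'y) diffpoly) ^ i = Var v ^ j" "i > 0"
  shows "u = v"
proof -
  have "Poly_Mapping.keys (Poly_Mapping.single (Poly_Mapping.single u i) (1::'k)) =
      Poly_Mapping.keys (Poly_Mapping.single (Poly_Mapping.single v j) (1::'k))"
    using assms(1) by (simp add: Var_power)
  then have "Poly_Mapping.keys (Poly_Mapping.single u i) = Poly_Mapping.keys (Poly_Mapping.single v j)"
    by simp
  then show ?thesis using \<open>i > 0\<close> by (auto split: if_splits)
qed

text \<open>Each application keeps a derivative or shifts it by \<open>e\<close>, so any number of
  shifts up to \<open>k\<close> can occur.\<close>

lemma vars_iterate_extend_deriv:
  assumes "v \<in> vars ((extend_deriv d e ^^ k) f)"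
  shows "\<exists>u\<in>vars f. \<exists>j\<le>k. v = ((act e) ^^ j) u"
  using assms
proof (induction k arbitrary: v)
  case 0
  then show ?case by auto
next
  case (Suc k)
  then consider "v \<in> vars ((extend_deriv d e ^^ k) f)"
    | v' where "v' \<in> vars ((extend_deriv d e ^^ k) f)" "v = act e v'"
    using vars_extend_deriv[of d e "(extend_deriv d e ^^ k) f"] by auto
  then show ?case
  proof cases
    case 1
    then show ?thesis using Suc.IH le_SucI by blast
  next
    case 2
    then obtain u j where "u \<in> vars f" "j \<le> k" "v' = (act e ^^ j) u" using Suc.IH by blast
    then show ?thesis using 2 by (intro bexI[of _ u] exI[of _ "Suc j"]) auto
  qed
qed


section \<open>Weights\<close>

lemma weight_act: "weight c1 c2 (act \<theta> v) = c1 * fst \<theta> + c2 * snd \<theta> + weight c1 c2 v"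
  by (simp add: weight_def act_def algebra_simps)

lemma weight_act_funpow: "weight c1 c2 ((act \<theta> ^^ k) v) = k * (c1 * fst \<theta> + c2 * snd \<theta>) + weight c1 c2 v"
  by (induction k) (simp_all add: weight_act algebra_simps)

lemma weight_vars_apply_theta:
  assumes "v \<in> vars (apply_theta d1 d2 \<theta> f)" "\<And>u. u \<in> vars f \<Longrightarrow> weight c1 c2 u \<le> W"
  shows "weight c1 c2 v \<le> c1 * fst \<theta> + c2 * snd \<theta> + W"
proof -
  obtain u j where u: "u \<in> vars ((extend_deriv d2 (0, 1) ^^ snd \<theta>) f)" "j \<le> fst \<theta>" "v = (act (1, 0) ^^ j) u"
    using assms(1) vars_iterate_extend_deriv unfolding apply_theta_def by blast
  obtain x i where x: "x \<in> vars f" "i \<le> snd \<theta>" "u = (act (0, 1) ^^ i) x"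
    using u(1) vars_iterate_extend_deriv by blast
  have "weight c1 c2 v = j * c1 + (i * c2 + weight c1 c2 x)"
    using u x by (simp add: weight_act_funpow)
  also have "\<dots> \<le> fst \<theta> * c1 + (snd \<theta> * c2 + W)"
    using u x assms(2) by (intro add_mono mult_right_mono) auto
  finally show ?thesis by (simp add: algebra_simps)
qed

section \<open>Weights of polynomials and divisibility of derivatives\<close>

lemma poly_weight_le_iff: "poly_weight c1 c2 f \<le> W \<longleftrightarrow> (\<forall>v\<in>vars f. weight c1 c2 v \<le> W)"
  by (simp add: poly_weight_def)

lemma set_weight_le_iff: "finite A \<Longrightarrow> set_weight c1 c2 A \<le> W \<longleftrightarrow> (\<forall>f\<in>A. poly_weight c1 c2 f \<le> W)"
  by (simp add: set_weight_def)

text \<open>The divisibility order on derivatives, in coordinates so as to match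
  \<open>prec_eq\<close>; \<open>below_iff_act\<close> gives the form with operators.\<close>

definition below :: "'y derivative \<Rightarrow> 'y derivative \<Rightarrow> bool" where
  "below u v \<longleftrightarrow> snd u = snd v \<and> fst (fst u) \<le> fst (fst v) \<and> snd (fst u) \<le> snd (fst v)"

lemma below_refl [simp]: "below u u"
  by (simp add: below_def)

lemma below_trans: "below u v \<Longrightarrow> below v w \<Longrightarrow> below u w"
  by (auto simp: below_def)

lemma below_antisym: "below u v \<Longrightarrow> below v u \<Longrightarrow> u = v"
  by (auto simp: below_def prod_eq_iff)

lemma below_iff_act: "below u v \<longleftrightarrow> (\<exists>\<theta>. v = act \<theta> u)"
proof
  assume "below u v"
  then have "v = act (fst (fst v) - fst (fst u), snd (fst v) - snd (fst u)) u"
    by (auto simp: below_def act_def prod_eq_iff)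
  then show "\<exists>\<theta>. v = act \<theta> u" by blast
qed (auto simp: below_def act_def)

lemma act_eq_self_iff: "act \<theta> u = u \<longleftrightarrow> \<theta> = 0"
  by (auto simp: act_def prod_eq_iff)

lemma act_zero [simp]: "act 0 u = u"
  by (simp add: act_eq_self_iff)

lemma proper_derivative_iff: "(\<exists>\<theta>. \<theta> \<noteq> 0 \<and> v = act \<theta> u) \<longleftrightarrow> below u v \<and> u \<noteq> v"
  using below_iff_act act_eq_self_iff by metis

lemma weight_mono: "below u v \<Longrightarrow> weight c1 c2 u \<le> weight c1 c2 v"
  by (auto simp: below_iff_act weight_act)

lemma weight_strict_mono:
  assumes "below u v" "u \<noteq> v" "c1 > 0" "c2 > 0"
  shows "weight c1 c2 u < weight c1 c2 v"
proof -
  obtain \<theta> where "v = act \<theta> u" using assms(1) by (auto simp: below_iff_act)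
  moreover from this have "\<theta> \<noteq> 0" using assms(2) by (auto simp: act_eq_self_iff)
  then have "c1 * fst \<theta> + c2 * snd \<theta> > 0" using assms by (auto simp: prod_eq_iff)
  ultimately show ?thesis by (simp add: weight_act)
qed

lemma weight_lcd_le: "weight c1 c2 (lcd u v) \<le> weight c1 c2 u + weight c1 c2 v"
proof -
  have "c1 * max (fst (fst u)) (fst (fst v)) \<le> c1 * fst (fst u) + c1 * fst (fst v)"
    "c2 * max (snd (fst u)) (snd (fst v)) \<le> c2 * snd (fst u) + c2 * snd (fst v)"
    by (simp_all add: max_def)
  then show ?thesis by (simp add: weight_def lcd_def)
qed

lemma lcd_below: "below u w \<Longrightarrow> below v w \<Longrightarrow> below (lcd u v) w"
  by (auto simp: below_def lcd_def)

lemma lcd_upper: "snd u = snd v \<Longrightarrow> below u (lcd u v) \<and> below v (lcd u v)"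
  by (auto simp: below_def lcd_def)

text \<open>The sum of the two weights exceeds that of the \<open>lcd\<close> by the weight of the
  coordinatewise minimum, so both minima vanish. Incomparability orders the two coordinates
  oppositely and strictly, so the zeros fall on different elements.\<close>

lemma weight_lcd_lossless:
  assumes "c1 > 0" "c2 > 0" "snd u = snd v" "\<not> below u v" "\<not> below v u"
    and "weight c1 c2 u + weight c1 c2 v \<le> weight c1 c2 (lcd u v)"
  shows "\<exists>a>0. \<exists>b>0. {u, v} = {((a, 0), snd u), ((0, b), snd u)}"
proof -
  obtain i j y where u: "u = ((i, j), y)" by (metis surj_pair)
  obtain k l where v: "v = ((k, l), y)" using u assms(3) by (metis snd_conv surj_pair)
  consider "i < k" "l < j" | "k < i" "j < l"
    using assms(4,5) by (auto simp: below_def u v)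
  then show ?thesis
  proof cases
    case 1
    then have "c1 * i + c2 * l \<le> 0" using assms(6) by (simp add: weight_def lcd_def u v)
    then have "i = 0" "l = 0" using assms(1,2) by auto
    then show ?thesis using 1 by (auto simp: u v)
  next
    case 2
    then have "c1 * k + c2 * j \<le> 0" using assms(6) by (simp add: weight_def lcd_def u v max_def)
    then have "k = 0" "j = 0" using assms(1,2) by auto
    then show ?thesis using 2 by (auto simp: u v)
  qed
qed


section \<open>Antichains of leaders\<close>

text \<open>Positivity of \<open>a\<close> and \<open>b\<close> prevents \<open>y\<close> itself
  from serving as both pure powers.\<close>

definition saturated :: "'y derivative set \<Rightarrow> 'y set" where
  "saturated E = {y. \<exists>a>0. \<exists>b>0. ((a, 0), y) \<in> E \<and> ((0, b), y) \<in> E}"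

lemma saturated_mono: "E \<subseteq> E' \<Longrightarrow> saturated E \<subseteq> saturated E'"
  by (auto simp: saturated_def)

text \<open>Equality is allowed because a reduced polynomial may share its leader with an element it
  is reduced by, in lower degree.\<close>

definition derivative_free :: "'y derivative set \<Rightarrow> 'y derivative \<Rightarrow> bool" where
  "derivative_free E v \<longleftrightarrow> (\<forall>e\<in>E. below e v \<longrightarrow> e = v)"

lemma derivative_free_mono: "E \<subseteq> E' \<Longrightarrow> derivative_free E' v \<Longrightarrow> derivative_free E v"
  by (auto simp: derivative_free_def)

locale weighted_elimination =
  fixes c1 c2 h :: nat and lt :: "'y::finite derivative \<Rightarrow> 'y derivative \<Rightarrow> bool"
  assumes c1_pos: "c1 > 0" and c2_pos: "c2 > 0" and weighted: "weighted_ranking c1 c2 lt"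
begin

abbreviation wt :: "'y derivative \<Rightarrow> nat" where
  "wt \<equiv> weight c1 c2"

text \<open>The saturation count is that of the whole list, so a newly saturated indeterminate can
  raise the bound at all positions at once.\<close>

definition bound :: "'y derivative list \<Rightarrow> nat \<Rightarrow> int" where
  "bound es = growth CARD('y) h (card (saturated (set es)))"

lemma bound_mono: "set es \<subseteq> set es' \<Longrightarrow> i \<le> j \<Longrightarrow> bound es i \<le> bound es' j"
  unfolding bound_def by (intro growth_mono card_mono saturated_mono) simp_all

definition weight_bounded :: "'y derivative list \<Rightarrow> bool" where
  "weight_bounded es \<longleftrightarrow> (\<forall>i<length es. int (wt (es ! i)) \<le> bound es (i + 1))"

text \<open>
  The last clause bounds the leaders that can arise from pairs of elements of the antichain.  The
  elements are listed in the order in which they joined, not by weight.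
\<close>

definition admissible :: "'y derivative list \<Rightarrow> bool" where
  "admissible es \<longleftrightarrow> (\<forall>e\<in>set es. \<forall>e'\<in>set es. below e e' \<longrightarrow> e = e') \<and> distinct es \<and>
     weight_bounded es \<and>
     (\<forall>e\<in>set es. \<forall>e'\<in>set es. e \<noteq> e' \<longrightarrow> snd e = snd e' \<longrightarrow>
       (\<forall>v. derivative_free (set es) v \<longrightarrow> wt v \<le> wt (lcd e e') \<longrightarrow>
         int (wt v) \<le> bound es (length es + 1)))"

lemma admissible_Nil: "admissible []"
  by (simp add: admissible_def weight_bounded_def)

lemma weight_bounded_append:
  assumes "weight_bounded es" "int (wt u) \<le> bound es (length es + 1)"
  shows "weight_bounded (es @ [u])"
  unfolding weight_bounded_def
proof (intro allI impI)
  fix i assume "i < length (es @ [u])"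
  then have "int (wt ((es @ [u]) ! i)) \<le> bound es (i + 1)"
    using assms by (cases "i < length es") (auto simp: nth_append weight_bounded_def less_Suc_eq)
  also have "\<dots> \<le> bound (es @ [u]) (i + 1)" by (intro bound_mono) auto
  finally show "int (wt ((es @ [u]) ! i)) \<le> bound (es @ [u]) (i + 1)" .
qed

text \<open>Distinct members occupy distinct positions, so by monotonicity the last two terms of the
  bound suffice for their sum.\<close>

lemma weight_bounded_pair:
  assumes "weight_bounded es" "e \<in> set es" "e' \<in> set es" "e \<noteq> e'"
  obtains k where "length es = k + 2" "int (wt e + wt e') \<le> bound es (k + 2) + bound es (k + 1)"
proof -
  have main: "\<exists>k. length es = k + 2 \<and> int (wt (es ! i) + wt (es ! j)) \<le> bound es (k + 2) + bound es (k + 1)"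
    if ij: "i < j" "j < length es" for i j
  proof -
    define k where "k = length es - 2"
    have k: "length es = k + 2" using ij by (simp add: k_def)
    have "int (wt (es ! i)) \<le> bound es (i + 1)" "int (wt (es ! j)) \<le> bound es (j + 1)"
      using assms(1) ij by (auto simp: weight_bounded_def)
    moreover have "bound es (i + 1) \<le> bound es (k + 1)" "bound es (j + 1) \<le> bound es (k + 2)"
      using ij k by (intro bound_mono; simp)+
    ultimately show ?thesis using k by (intro exI[of _ k]) simp
  qed
  obtain i j where ij: "i < length es" "j < length es" "e = es ! i" "e' = es ! j"
    using assms(2,3) by (metis in_set_conv_nth)
  then have "i \<noteq> j" using assms(4) by auto
  then show thesis using main[of i j] main[of j i] ij that by (metis add.commute linorder_neqE_nat)
qed

text \<open>The strict inequality pays for the 1 that the recursion subtracts.\<close>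

lemma wt_lcd_lossy:
  assumes "weight_bounded es" "e \<in> set es" "e' \<in> set es" "e \<noteq> e'" "wt u < wt e + wt e'"
  shows "int (wt u) \<le> bound es (length es + 1)"
proof -
  obtain k where k: "length es = k + 2" "int (wt e + wt e') \<le> bound es (k + 2) + bound es (k + 1)"
    using assms(1-4) by (rule weight_bounded_pair)
  have "int (wt u) \<le> bound es (k + 2) + bound es (k + 1) - 1" using k assms(5) by linarith
  also have "\<dots> \<le> bound es (k + 3)" unfolding bound_def by (rule growth_step)
  finally show ?thesis using k by (simp add: numeral_3_eq_3)
qed

text \<open>
  A pair whose least common derivative has the full weight saturates its indeterminate, which pays
  for the lossless step of the bound.  Once all indeterminates are saturated, every derivative of
  that weight is already a derivative of an element of the antichain.
\<close>

lemma lossless_pair: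
  assumes wb: "weight_bounded es" and u: "int (wt u) \<le> bound es (length es + 1)"
    and incomp: "\<And>e. e \<in> set es \<Longrightarrow> \<not> below e u \<and> \<not> below u e"
    and e: "e \<in> set es" "snd e = snd u"
    and v: "derivative_free (set (es @ [u])) v" "wt v \<le> wt (lcd u e)"
  shows "int (wt v) \<le> bound (es @ [u]) (length es + 2)"
proof -
  let ?es = "es @ [u]" and ?r = "card (saturated (set es))"
  have wb': "weight_bounded ?es" using wb u by (rule weight_bounded_append)
  have ne: "u \<noteq> e" using incomp[OF e(1)] by auto
  show ?thesis
  proof (cases "wt v < wt u + wt e")
    case True
    then show ?thesis using wt_lcd_lossy[OF wb' _ _ ne] e by simp
  next
    case False
    then have "wt u + wt e \<le> wt (lcd u e)" using v(2) by linarith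
    then obtain a b where ab: "a > 0" "b > 0" "{u, e} = {((a, 0), snd u), ((0, b), snd u)}"
      using weight_lcd_lossless[OF c1_pos c2_pos, of u e] incomp e by auto
    then have "((a, 0), snd u) \<in> set ?es" "((0, b), snd u) \<in> set ?es"
      using e by (auto simp: doubleton_eq_iff)
    then have sat: "snd u \<in> saturated (set ?es)"
      using ab by (auto simp: saturated_def)
    \<comment> \<open>\<open>u\<close> is itself a pure power, and an earlier pure power on the same
      axis would be comparable to it.\<close>
    have unsat: "snd u \<notin> saturated (set es)"
    proof
      assume "snd u \<in> saturated (set es)"
      then obtain a' b' where ab': "((a', 0), snd u) \<in> set es" "((0, b'), snd u) \<in> set es"
        by (auto simp: saturated_def)
      have "u \<in> {((a, 0), snd u), ((0, b), snd u)}" using ab(3) by blast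
      then consider "fst u = (a, 0)" | "fst u = (0, b)" by (metis fst_conv insertE singletonD)
      then show False
      proof cases
        case 1
        then show False using incomp[OF ab'(1)] by (auto simp: below_def)
      next
        case 2
        then show False using incomp[OF ab'(2)] by (auto simp: below_def)
      qed
    qed
    have "saturated (set es) \<subset> saturated (set ?es)"
      using sat unsat saturated_mono[of "set es" "set ?es"] by auto
    then have r': "Suc ?r \<le> card (saturated (set ?es))"
      by (intro Suc_leI psubset_card_mono) simp_all
    show ?thesis
    proof (cases "Suc ?r < CARD('y)")
      case True
      have wu: "\<exists>k. length es = k + 1 \<and> int (wt e) \<le> bound es (k + 1)"
      proof -
        obtain i where i: "i < length es" "e = es ! i" using e by (metis in_set_conv_nth)
        then obtain k where k: "length es = k + 1" by (cases "length es") auto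
        have "int (wt e) \<le> bound es (i + 1)" using wb i by (auto simp: weight_bounded_def)
        also have "\<dots> \<le> bound es (k + 1)" using i k by (intro bound_mono) auto
        finally show ?thesis using k by blast
      qed
      then obtain k where k: "length es = k + 1" "int (wt e) \<le> bound es (k + 1)" by blast
      have "int (wt v) \<le> int (wt u) + int (wt e)"
        using v(2) weight_lcd_le[of c1 c2 u e] by linarith
      \<comment> \<open>Both weights are measured with the old saturation count; the increase of
        that count then buys their full sum.\<close>
      also have "\<dots> \<le> bound es (k + 2) + bound es (k + 1)" using u k by simp
      also have "\<dots> \<le> growth CARD('y) h (Suc ?r) (k + 3)"
        unfolding bound_def using True by (intro growth_lossless) simp
      also have "\<dots> \<le> bound ?es (k + 3)"
        unfolding bound_def by (intro growth_mono r') simp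
      finally show ?thesis using k by (simp add: numeral_3_eq_3)
    next
      case False
      then have "card (saturated (set ?es)) = CARD('y)"
        using r' card_mono[of "UNIV :: 'y set" "saturated (set ?es)"] by simp
      \<comment> \<open>From here on \<open>v\<close> is compared with the pure pair of its own
        indeterminate, which may differ from that of \<open>u\<close>. A strict deficit against that
        pair suffices for the lossy recursion.\<close>
      then have "snd v \<in> saturated (set ?es)"
        using card_subset_eq[of "UNIV :: 'y set"] by auto
      then obtain a b where ab: "a > 0" "b > 0" "((a, 0), snd v) \<in> set ?es" "((0, b), snd v) \<in> set ?es"
        by (auto simp: saturated_def)
      have "wt v < wt ((a, 0), snd v) + wt ((0, b), snd v)"
      proof (rule ccontr)
        assume "\<not> ?thesis"
        then have le: "c1 * a + c2 * b \<le> c1 * fst (fst v) + c2 * snd (fst v)"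
          by (simp add: weight_def)
        \<comment> \<open>A derivative strictly inside the rectangle would be too light. Outside it
          \<open>v\<close> is divisible by a pure power, hence equal to it, and again too
          light.\<close>
        have "\<not> (fst (fst v) < a \<and> snd (fst v) < b)"
          using le c1_pos c2_pos by (metis add_less_mono linorder_not_less mult_less_cancel1)
        then consider "below ((a, 0), snd v) v" | "below ((0, b), snd v) v"
          by (auto simp: below_def)
        then have "v = ((a, 0), snd v) \<or> v = ((0, b), snd v)"
          using v(1) ab(3,4) by cases (auto simp: derivative_free_def)
        then show False
        proof
          assume "v = ((a, 0), snd v)"
          then have "fst (fst v) = a" "snd (fst v) = 0" by (metis fst_conv snd_conv)+
          then show False using le ab c2_pos by simp
        next
          assume "v = ((0, b), snd v)"
          then have "fst (fst v) = 0" "snd (fst v) = b" by (metis fst_conv snd_conv)+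
          then show False using le ab c1_pos by simp
        qed
      qed
      then show ?thesis
        using wt_lcd_lossy[OF wb' ab(3,4)] ab(1) by simp
    qed
  qed
qed

text \<open>\<open>lcd\<close> takes its indeterminate from the first argument, hence the
  hypothesis.\<close>

lemma lcd_commute: "snd u = snd v \<Longrightarrow> lcd u v = lcd v u"
  by (simp add: lcd_def max.commute)

text \<open>For pairs of old members the bound persists by monotonicity; pairs that involve
  \<open>u\<close> are the subject of \<open>lossless_pair\<close>.\<close>

lemma admissible_append:
  assumes adm: "admissible es" and u: "int (wt u) \<le> bound es (length es + 1)"
    and incomp: "\<And>e. e \<in> set es \<Longrightarrow> \<not> below e u \<and> \<not> below u e"
  shows "admissible (es @ [u])"
proof -
  have wb: "weight_bounded es" using adm by (simp add: admissible_def)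
  have "weight_bounded (es @ [u])" using wb u by (rule weight_bounded_append)
  moreover have "int (wt v) \<le> bound (es @ [u]) (length (es @ [u]) + 1)"
    if ee: "e \<in> set (es @ [u])" "e' \<in> set (es @ [u])" "e \<noteq> e'" "snd e = snd e'"
      and v: "derivative_free (set (es @ [u])) v" "wt v \<le> wt (lcd e e')" for e e' v
  proof -
    consider "e \<in> set es" "e' \<in> set es" | "e = u" "e' \<in> set es" | "e \<in> set es" "e' = u"
      using ee by auto
    then show ?thesis
    proof cases
      case 1
      have "derivative_free (set es) v" using v(1) by (rule derivative_free_mono[rotated]) auto
      then have "int (wt v) \<le> bound es (length es + 1)"
        using adm 1 that unfolding admissible_def by blast
      also have "\<dots> \<le> bound (es @ [u]) (length (es @ [u]) + 1)" by (intro bound_mono) auto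
      finally show ?thesis .
    next
      case 2
      then show ?thesis using lossless_pair[OF wb u incomp] that by simp
    next
      case 3
      then show ?thesis using lossless_pair[OF wb u incomp] that lcd_commute[of e u] by simp
    qed
  qed
  moreover have "u \<notin> set es" using incomp[of u] by auto
  ultimately show ?thesis
    using adm incomp unfolding admissible_def by auto
qed

text \<open>Current leaders may have dropped below the recorded members. If both lie below one
  member, so does their \<open>lcd\<close>; if both are still members, admissibility applies;
  otherwise the drop makes the sum of weights strictly smaller and the lossy recursion
  suffices.\<close>

lemma admissible_lcd:
  assumes adm: "admissible es" and uv: "snd u = snd v" "\<not> below u v" "\<not> below v u"
    and ee: "e \<in> set es" "e' \<in> set es" "below u e" "below v e'"
    and x: "derivative_free (set es) x" "wt x \<le> wt (lcd u v)"
  shows "int (wt x) \<le> bound es (length es + 1)"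
proof -
  have wb: "weight_bounded es" using adm by (simp add: admissible_def)
  consider "e = e'" | "e \<noteq> e'" "u = e" "v = e'" | "e \<noteq> e'" "u \<noteq> e \<or> v \<noteq> e'" by blast
  then show ?thesis
  proof cases
    case 1
    obtain i where i: "i < length es" "e = es ! i" using ee by (metis in_set_conv_nth)
    have "wt (lcd u v) \<le> wt e" using 1 ee by (intro weight_mono lcd_below) auto
    then have "int (wt x) \<le> int (wt e)" using x by simp
    also have "\<dots> \<le> bound es (i + 1)" using wb i by (auto simp: weight_bounded_def)
    also have "\<dots> \<le> bound es (length es + 1)" using i by (intro bound_mono) auto
    finally show ?thesis .
  next
    case 2
    then show ?thesis using adm ee uv x unfolding admissible_def by blast
  next
    case 3
    have "wt u + wt v < wt e + wt e'"
      using 3(2) ee(3,4) weight_strict_mono[OF _ _ c1_pos c2_pos] weight_mono[of u e c1 c2]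
        weight_mono[of v e' c1 c2] by (metis add_le_less_mono add_less_le_mono)
    then have "wt x < wt e + wt e'" using x(2) weight_lcd_le[of c1 c2 u v] by linarith
    then show ?thesis using wt_lcd_lossy[OF wb ee(1,2) 3(1)] by simp
  qed
qed

text \<open>If \<open>u\<close> divides a member, the list stays as it is. Otherwise
  \<open>free\<close> excludes divisibility in the other direction too, and \<open>u\<close> can be
  appended.\<close>

lemma admissible_insert:
  assumes adm: "admissible es" and u: "int (wt u) \<le> bound es (length es + 1)"
    and free: "derivative_free (set es) u"
  obtains es' where "admissible es'" "set es \<subseteq> set es'" "set es' \<subseteq> insert u (set es)"
    "\<exists>e\<in>set es'. below u e" "length es \<le> length es'"
proof (cases "\<exists>e\<in>set es. below u e")
  case True
  then show ?thesis using that[of es] adm by blast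
next
  case False
  moreover have "\<not> below e u" if "e \<in> set es" for e
    using that free False by (auto simp: derivative_free_def)
  ultimately have "admissible (es @ [u])" using adm u by (intro admissible_append) auto
  then show ?thesis using that[of "es @ [u]"] by auto
qed

text \<open>Numbering the indeterminates turns the list into an antichain sequence that competes in
  the definition of the maximal length.\<close>

lemma antichain_length_le:
  assumes adm: "admissible es" and "h > 0"
  shows "length es \<le> max_antichain_length CARD('y) (bound_seq CARD('y) h)"
proof -
  obtain g' where "bij_betw g' {1..CARD('y)} (UNIV :: 'y set)"
    using ex_bij_betw_nat_finite_1[of "UNIV :: 'y set"] by auto
  then obtain g where g: "bij_betw g (UNIV :: 'y set) {1..CARD('y)}"
    using bij_betw_inv by blast
  let ?ss = "map (\<lambda>e. (fst e, g (snd e))) es"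
  have inj: "g x = g y \<longleftrightarrow> x = y" for x y
    using g by (auto simp: bij_betw_def inj_on_def)
  have "antichain_sequence CARD('y) ?ss"
    unfolding antichain_sequence_def
  proof (intro conjI ballI allI impI)
    show "snd s \<in> {1..CARD('y)}" if "s \<in> set ?ss" for s
      using that g by (auto simp: bij_betw_def)
    show "\<not> prec_eq (?ss ! i) (?ss ! j)" if "i < length ?ss" "j < length ?ss" "i \<noteq> j" for i j
    proof -
      have "es ! i \<noteq> es ! j" using adm that by (simp add: admissible_def nth_eq_iff_index_eq)
      then have "\<not> below (es ! i) (es ! j)" using adm that by (auto simp: admissible_def)
      then show ?thesis using that inj by (simp add: below_def prec_eq_def)
    qed
  qed
  moreover have "degree_growth_bounded (bound_seq CARD('y) h) ?ss"
    unfolding degree_growth_bounded_def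
  proof (intro allI impI)
    fix i assume i: "i < length ?ss"
    \<comment> \<open>Weight dominates degree because \<open>c1\<close> and \<open>c2\<close> are at
      least 1.\<close>
    have "fst (fst (?ss ! i)) + snd (fst (?ss ! i)) \<le> wt (es ! i)"
      using i c1_pos c2_pos by (simp add: weight_def add_mono)
    then have "int (fst (fst (?ss ! i)) + snd (fst (?ss ! i))) \<le> int (wt (es ! i))" by simp
    also have "\<dots> \<le> bound es (i + 1)"
      using adm i by (simp add: admissible_def weight_bounded_def)
    also have "\<dots> \<le> bound_seq CARD('y) h (i + 1)"
      unfolding bound_def using \<open>h > 0\<close> by (rule growth_le_bound_seq)
    finally show "int (fst (fst (?ss ! i)) + snd (fst (?ss ! i))) \<le> bound_seq CARD('y) h (i + 1)" .
  qed
  ultimately have "length ?ss \<le> max_antichain_length CARD('y) (bound_seq CARD('y) h)"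
    by (rule length_le_max_antichain_length)
  then show ?thesis by simp
qed

lemma bound_le_bound_seq:
  assumes "admissible es"
  shows "bound es (length es + 1) \<le>
    bound_seq CARD('y) h (max_antichain_length CARD('y) (bound_seq CARD('y) h) + 1)"
proof (cases "h = 0")
  case True
  \<comment> \<open>The left side is 0. The maximal length is at most \<open>n\<close>, so the right
    side is 0 as well and not negative.\<close>
  then show ?thesis
    using bound_seq_zero[of "max_antichain_length CARD('y) (bound_seq CARD('y) 0) + 1" "CARD('y)"]
      max_antichain_length_zero[of "CARD('y)"]
    unfolding bound_def by (simp add: growth_def)
next
  case False
  then have "bound es (length es + 1) \<le> bound_seq CARD('y) h (length es + 1)"
    unfolding bound_def by (intro growth_le_bound_seq) simp
  also have "\<dots> \<le> bound_seq CARD('y) h (max_antichain_length CARD('y) (bound_seq CARD('y) h) + 1)"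
    using antichain_length_le[OF assms] False by (intro bound_seq_mono) simp_all
  finally show ?thesis .
qed


section \<open>Leaders and reduction under a weighted ranking\<close>

lemma lt_irrefl: "\<not> lt u u"
  and lt_trans: "lt u v \<Longrightarrow> lt v w \<Longrightarrow> lt u w"
  and lt_total: "u \<noteq> v \<Longrightarrow> lt u v \<or> lt v u"
  and lt_of_wt: "wt u < wt v \<Longrightarrow> lt u v"
  using weighted unfolding weighted_ranking_def ranking_def irreflp_def transp_def totalp_on_def
  by blast+

text \<open>Gives access to the theory of sorted lists, for the list of leaders chosen in
  \<open>auto_partial_reduce\<close>.\<close>

lemma lt_linorder: "class.linorder (\<lambda>u v. lt u v \<or> u = v) lt"
  by unfold_locales (use lt_irrefl lt_trans lt_total in blast)+

text \<open>The contrapositive of the weight condition on the ranking; through it, comparisons of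
  rank control weights.\<close>

lemma lt_imp_wt_le: "lt u v \<Longrightarrow> wt u \<le> wt v"
  using lt_irrefl lt_trans lt_of_wt by (metis linorder_not_less)

text \<open>A finite nonempty set has a greatest element for a total order, which justifies the
  description in \<open>lead\<close>.\<close>

lemma lead_unique:
  assumes "f \<notin> ground"
  shows "lead lt f \<in> vars f \<and> (\<forall>u\<in>vars f. u \<noteq> lead lt f \<longrightarrow> lt u (lead lt f))"
proof -
  have "\<exists>v\<in>S. \<forall>u\<in>S. u \<noteq> v \<longrightarrow> lt u v" if "finite S" "S \<noteq> {}" for S :: "'y derivative set"
    using that
  proof (induction S rule: finite_ne_induct)
    case (insert x S)
    then obtain v where v: "v \<in> S" "\<forall>u\<in>S. u \<noteq> v \<longrightarrow> lt u v" by blast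
    show ?case
    proof (cases "lt v x")
      case True
      then have "\<forall>u\<in>insert x S. u \<noteq> x \<longrightarrow> lt u x" using v(2) lt_trans by (metis insertE)
      then show ?thesis by blast
    next
      case False
      moreover have "x \<noteq> v" using v insert by blast
      ultimately have "lt x v" using lt_total by blast
      then show ?thesis using v by blast
    qed
  qed simp
  then obtain v where v: "v \<in> vars f \<and> (\<forall>u\<in>vars f. u \<noteq> v \<longrightarrow> lt u v)"
    using assms vars_eq_empty_iff finite_vars by metis
  show ?thesis
    unfolding lead_def
  proof (rule theI[of _ v])
    fix w assume "w \<in> vars f \<and> (\<forall>u\<in>vars f. u \<noteq> w \<longrightarrow> lt u w)"
    then show "w = v" using v lt_irrefl lt_trans by metis
  qed (rule v)
qed

lemma lead_in_vars: "f \<notin> ground \<Longrightarrow> lead lt f \<in> vars f"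
  using lead_unique by blast

lemma not_ground_if_vars: "v \<in> vars f \<Longrightarrow> f \<notin> ground"
  using vars_eq_empty_iff by blast

lemma wt_vars_le_lead: "v \<in> vars f \<Longrightarrow> wt v \<le> wt (lead lt f)"
  using lead_unique not_ground_if_vars lt_imp_wt_le by (cases "v = lead lt f") blast+

lemma lead_Var [simp]: "lead lt (Var v) = v"
  using lead_in_vars[of "Var v"] by simp

lemma vars_init: "vars (init lt f) \<subseteq> vars f"
  unfolding init_def by (rule vars_coeff_in)

lemma vars_sep: "vars (sep lt f) \<subseteq> vars f"
  unfolding sep_def by (rule vars_partial)

lemma lead_eq_if_rank_eq:
  assumes "rank lt f = rank lt g" "f \<notin> ground"
  shows "lead lt f = lead lt g"
  using assms Var_power_inject deg_in_pos[OF lead_in_vars] unfolding rank_def by metis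

text \<open>The leader carries the maximal weight, so a reduction that does not raise the rank does
  not raise the weight.\<close>

lemma rank_le_wt:
  assumes "rank_le lt f g" "v \<in> vars f"
  shows "\<exists>x\<in>vars g. wt v \<le> wt x"
proof -
  have "f \<notin> ground" using assms(2) by (rule not_ground_if_vars)
  then have g: "g \<notin> ground" and "lt (lead lt f) (lead lt g) \<or> lead lt f = lead lt g"
    using assms(1) by (auto simp: rank_le_def)
  then have wt: "wt (lead lt f) \<le> wt (lead lt g)"
    using lt_imp_wt_le[of "lead lt f" "lead lt g"] by auto
  then show ?thesis
    using lead_in_vars[OF g] wt_vars_le_lead[OF assms(2)] le_trans[OF _ wt] by blast
qed

lemma reduced_Var_iff: "u \<noteq> v \<Longrightarrow> reduced lt (Var u) (Var v) \<longleftrightarrow> \<not> below v u"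
  using proper_derivative_iff[of u v]
  by (auto simp: reduced_def partially_reduced_def deg_in_Var)

text \<open>Between distinct variables the degree condition of \<open>reduced\<close> is automatic,
  so autoreducedness of the leaders says that they form an antichain for
  \<open>below\<close>.\<close>

lemma weak_d_triangular_iff:
  fixes A :: "('k::field_char_0, 'y) diffpoly set"
  shows "weak_d_triangular lt A \<longleftrightarrow> A \<inter> ground = {} \<and> inj_on (lead lt) A \<and>
     (\<forall>a\<in>A. \<forall>b\<in>A. below (lead lt a) (lead lt b) \<longrightarrow> lead lt a = lead lt b)"
proof -
  have inj: "(Var u :: ('k, 'y) diffpoly) = Var v \<longleftrightarrow> u = v" for u v
    using lead_Var by metis
  have "autoreduced lt (Var ` lead lt ` A :: ('k, 'y) diffpoly set) \<longleftrightarrow>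
      (\<forall>a\<in>A. \<forall>b\<in>A. below (lead lt a) (lead lt b) \<longrightarrow> lead lt a = lead lt b)"
  proof -
    have "autoreduced lt (Var ` lead lt ` A :: ('k, 'y) diffpoly set) \<longleftrightarrow>
        (\<forall>f\<in>A. \<forall>g\<in>A. lead lt f \<noteq> lead lt g \<longrightarrow>
          reduced lt (Var (lead lt f) :: ('k, 'y) diffpoly) (Var (lead lt g)))"
      unfolding autoreduced_def by (auto simp: inj)
    also have "\<dots> \<longleftrightarrow>
        (\<forall>f\<in>A. \<forall>g\<in>A. lead lt f \<noteq> lead lt g \<longrightarrow> \<not> below (lead lt g) (lead lt f))"
      by (intro ball_cong imp_cong refl reduced_Var_iff)
    also have "\<dots> \<longleftrightarrow> (\<forall>a\<in>A. \<forall>b\<in>A. below (lead lt a) (lead lt b) \<longrightarrow> lead lt a = lead lt b)"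
      by metis
    finally show ?thesis .
  qed
  then show ?thesis by (auto simp: weak_d_triangular_def)
qed

section \<open>Weights of Delta-polynomials\<close>

lemma wt_apply_theta_lead:
  assumes "v \<in> vars (apply_theta d1 d2 (fst l - fst (lead lt f)) f)" "below (lead lt f) l"
  shows "wt v \<le> wt l"
proof -
  let ?\<phi> = "fst l - fst (lead lt f)"
  have "wt v \<le> c1 * fst ?\<phi> + c2 * snd ?\<phi> + wt (lead lt f)"
    using assms(1) by (rule weight_vars_apply_theta) (rule wt_vars_le_lead)
  also have "\<dots> = wt (act ?\<phi> (lead lt f))" by (simp add: weight_act)
  also have "act ?\<phi> (lead lt f) = l" using assms(2) by (auto simp: act_def below_def prod_eq_iff)
  finally show ?thesis .
qed

text \<open>Both leaders divide the \<open>lcd\<close>, and the operators carry them exactly to it,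
  so no factor is heavier. For different indeterminates the polynomial is 0 and has no
  \<open>v\<close>.\<close>

lemma wt_delta_poly:
  assumes "v \<in> vars (delta_poly d1 d2 lt f g)"
  shows "snd (lead lt f) = snd (lead lt g) \<and> wt v \<le> wt (lcd (lead lt f) (lead lt g))"
proof -
  have same: "snd (lead lt f) = snd (lead lt g)"
    using assms by (auto simp: delta_poly_def split: if_splits)
  let ?l = "lcd (lead lt f) (lead lt g)"
  have up: "below (lead lt f) ?l" "below (lead lt g) ?l" using lcd_upper[OF same] by auto
  let ?P = "apply_theta d1 d2 (fst ?l - fst (lead lt f)) f"
  let ?Q = "apply_theta d1 d2 (fst ?l - fst (lead lt g)) g"
  have "delta_poly d1 d2 lt f g = sep lt g * ?P - sep lt f * ?Q"
    using same by (simp add: delta_poly_def Let_def)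
  then have "v \<in> vars (sep lt g) \<union> vars ?P \<union> (vars (sep lt f) \<union> vars ?Q)"
    using assms vars_diff[of "sep lt g * ?P" "sep lt f * ?Q"]
      vars_mult[of "sep lt g" ?P] vars_mult[of "sep lt f" ?Q] by auto
  then consider "v \<in> vars g" | "v \<in> vars f"
    | "v \<in> vars ?P" | "v \<in> vars ?Q"
    using vars_sep by blast
  then have "wt v \<le> wt ?l"
  proof cases
    case 1
    then show ?thesis using wt_vars_le_lead weight_mono[OF up(2)] le_trans by blast
  next
    case 2
    then show ?thesis using wt_vars_le_lead weight_mono[OF up(1)] le_trans by blast
  qed (use wt_apply_theta_lead up in blast)+
  then show ?thesis using same by blast
qed


section \<open>The invariant of the main loop\<close>

text \<open>The bound is an integer, to fit \<open>bound\<close>, and no \<open>Max\<close> over a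
  set is involved.\<close>

definition weights_le :: "int \<Rightarrow> ('k::field_char_0, 'y) diffpoly \<Rightarrow> bool" where
  "weights_le W f \<longleftrightarrow> (\<forall>v\<in>vars f. int (wt v) \<le> W)"

lemma weights_le_subset: "vars f \<subseteq> vars g \<Longrightarrow> weights_le W g \<Longrightarrow> weights_le W f"
  by (auto simp: weights_le_def)

lemma weights_le_trans: "weights_le W f \<Longrightarrow> W \<le> W' \<Longrightarrow> weights_le W' f"
  by (fastforce simp: weights_le_def)

lemma weights_le_rank: "rank_le lt f g \<Longrightarrow> weights_le W g \<Longrightarrow> weights_le W f"
  unfolding weights_le_def using rank_le_wt by (metis of_nat_le_iff order_trans)

lemma weights_le_initials_separants:
  "\<forall>f\<in>A. weights_le W f \<Longrightarrow> \<forall>f\<in>initials_separants lt A. weights_le W f"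
  unfolding initials_separants_def using weights_le_subset vars_init vars_sep by blast

text \<open>
  Elements of \<open>D\<close> may exceed the bound: in the last lossless step only the leaders of their reduced
  forms, which are proper derivatives of no member of the antichain \<open>es\<close>, obey it.
\<close>

definition controlled_by :: "'y derivative list \<Rightarrow> ('k::field_char_0, 'y) diffpoly set \<Rightarrow>
    ('k, 'y) diffpoly set \<Rightarrow> ('k, 'y) diffpoly set \<Rightarrow> ('k, 'y) diffpoly set \<Rightarrow> bool" where
  "controlled_by es G D A H \<longleftrightarrow> admissible es \<and> finite A \<and> finite H \<and> weak_d_triangular lt A \<and>
     (\<forall>f\<in>G \<union> A \<union> H. weights_le (bound es (length es + 1)) f) \<and>
     (\<forall>f\<in>D. \<forall>v. derivative_free (set es) v \<longrightarrow> (\<exists>x\<in>vars f. wt v \<le> wt x) \<longrightarrow>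
        int (wt v) \<le> bound es (length es + 1)) \<and>
     (\<forall>a\<in>A. \<exists>e\<in>set es. below (lead lt a) e) \<and>
     (\<forall>e\<in>set es. \<exists>a\<in>A. below (lead lt a) e)"

definition controlled :: "('k::field_char_0, 'y) rg_tuple \<Rightarrow> bool" where
  "controlled T \<longleftrightarrow> (case T of (G, D, A, H) \<Rightarrow> \<exists>es. controlled_by es G D A H)"

text \<open>The antichain absorbs the leader of \<open>q\<close> unless that leader divides a
  member. New Delta-polynomials are covered by \<open>admissible_lcd\<close>; polynomials moved from
  \<open>A\<close> to \<open>G\<close> already obey the bound.\<close>

lemma controlled_update:
  assumes ctl: "controlled_by es G D A H" and q: "q \<notin> ground"
    and wq: "int (wt (lead lt q)) \<le> bound es (length es + 1)"
    and red: "\<And>a. a \<in> A \<Longrightarrow> below (lead lt a) (lead lt q) \<Longrightarrow> lead lt a = lead lt q"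
  shows "controlled (update d1 d2 lt G D A H q)"
proof -
  let ?u = "lead lt q"
  define GA where "GA = {a \<in> A. below ?u (lead lt a)}"
  define A' where "A' = A - GA"
  define D' where "D' = (D \<union> delta_poly d1 d2 lt q ` A') - {0}"
  have upd: "update d1 d2 lt G D A H q = (G \<union> GA, D', A' \<union> {q}, H \<union> {sep lt q, init lt q})"
    by (simp add: update_def Let_def GA_def A'_def D'_def below_iff_act image_def)
  note c = ctl[unfolded controlled_by_def]
  \<comment> \<open>A member \<open>e\<close> below \<open>?u\<close> lies above some leader of
    \<open>A\<close>, which by \<open>red\<close> is \<open>?u\<close> itself; so \<open>e\<close>
    equals \<open>?u\<close>.\<close>
  have free: "derivative_free (set es) ?u"
    unfolding derivative_free_def
  proof (intro ballI impI)
    fix e assume e: "e \<in> set es" "below e ?u"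
    then obtain a where a: "a \<in> A" "below (lead lt a) e" using c by blast
    then have "lead lt a = ?u" using red below_trans e by blast
    then show "e = ?u" using a(2) e(2) below_antisym by metis
  qed
  obtain es' where es': "admissible es'" "set es \<subseteq> set es'" "set es' \<subseteq> insert ?u (set es)"
    "\<exists>e\<in>set es'. below ?u e" "length es \<le> length es'"
    using admissible_insert[OF _ wq free] c by blast
  let ?W = "bound es (length es + 1)" and ?W' = "bound es' (length es' + 1)"
  have W: "?W \<le> ?W'" using es' by (intro bound_mono) auto
  have wtq: "weights_le ?W q"
    unfolding weights_le_def using wt_vars_le_lead wq by (meson of_nat_mono order_trans)
  have A'_below: "\<exists>e\<in>set es'. below (lead lt a) e" if "a \<in> A' \<union> {q}" for a
  proof (cases "a = q")
    case False
    then have "a \<in> A" using that by (auto simp: A'_def)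
    then show ?thesis using c es'(2) by blast
  qed (use es'(4) in simp)
  have weak: "A \<inter> ground = {}" "inj_on (lead lt) A"
    "\<And>a b. a \<in> A \<Longrightarrow> b \<in> A \<Longrightarrow> below (lead lt a) (lead lt b) \<Longrightarrow> lead lt a = lead lt b"
    using c by (auto simp: weak_d_triangular_iff)
  \<comment> \<open>A leader kept in \<open>A'\<close> is no derivative of \<open>?u\<close>; if it
    divided \<open>?u\<close>, \<open>red\<close> would equate the two.\<close>
  have incomp: "\<not> below ?u (lead lt a)" "\<not> below (lead lt a) ?u" if "a \<in> A'" for a
    using that red[of a] by (auto simp: A'_def GA_def)
  have "controlled_by es' (G \<union> GA) D' (A' \<union> {q}) (H \<union> {sep lt q, init lt q})"
    unfolding controlled_by_def
  proof (intro conjI)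
    show "admissible es'" by fact
    show "finite (A' \<union> {q})" "finite (H \<union> {sep lt q, init lt q})" using c by (auto simp: A'_def)
    show "weak_d_triangular lt (A' \<union> {q})"
      unfolding weak_d_triangular_iff
    proof (intro conjI)
      show "(A' \<union> {q}) \<inter> ground = {}" using weak q by (auto simp: A'_def)
      have "?u \<noteq> lead lt a" if "a \<in> A'" for a using incomp[OF that] by auto
      moreover have "inj_on (lead lt) A'" using weak(2) by (rule inj_on_subset) (simp add: A'_def)
      ultimately show "inj_on (lead lt) (A' \<union> {q})"
        unfolding Un_insert_right Un_empty_right inj_on_insert by blast
      show "\<forall>a\<in>A' \<union> {q}. \<forall>b\<in>A' \<union> {q}. below (lead lt a) (lead lt b) \<longrightarrow> lead lt a = lead lt b"
        using incomp weak(3) by (auto simp: A'_def)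
    qed
    show "\<forall>f\<in>G \<union> GA \<union> (A' \<union> {q}) \<union> (H \<union> {sep lt q, init lt q}). weights_le ?W' f"
    proof
      fix f assume "f \<in> G \<union> GA \<union> (A' \<union> {q}) \<union> (H \<union> {sep lt q, init lt q})"
      then consider "f \<in> G \<union> A \<union> H" | "vars f \<subseteq> vars q"
        using vars_sep vars_init by (auto simp: A'_def GA_def)
      then have "weights_le ?W f" using c wtq weights_le_subset by cases blast+
      then show "weights_le ?W' f" using W by (rule weights_le_trans)
    qed
    show "\<forall>f\<in>D'. \<forall>v. derivative_free (set es') v \<longrightarrow> (\<exists>x\<in>vars f. wt v \<le> wt x) \<longrightarrow> int (wt v) \<le> ?W'"
    proof (intro ballI allI impI)
      fix f v assume f: "f \<in> D'" and v: "derivative_free (set es') v" "\<exists>x\<in>vars f. wt v \<le> wt x"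
      consider "f \<in> D" | a where "a \<in> A'" "f = delta_poly d1 d2 lt q a"
        using f by (auto simp: D'_def)
      then show "int (wt v) \<le> ?W'"
      proof cases
        case 1
        then have "int (wt v) \<le> ?W"
          using c v derivative_free_mono[OF es'(2)] by blast
        then show ?thesis using W by simp
      next
        case 2
        then obtain x where x: "x \<in> vars (delta_poly d1 d2 lt q a)" "wt v \<le> wt x" using v by blast
        then have x': "snd ?u = snd (lead lt a)" "wt v \<le> wt (lcd ?u (lead lt a))"
          using wt_delta_poly[OF x(1)] by auto
        obtain e e' where "e \<in> set es'" "e' \<in> set es'" "below ?u e" "below (lead lt a) e'"
          using A'_below 2(1) by blast
        then show ?thesis
          using admissible_lcd[OF es'(1) x'(1) incomp[OF 2(1)] _ _ _ _ v(1) x'(2)] by blast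
      qed
    qed
    show "\<forall>a\<in>A' \<union> {q}. \<exists>e\<in>set es'. below (lead lt a) e" using A'_below by blast
    show "\<forall>e\<in>set es'. \<exists>a\<in>A' \<union> {q}. below (lead lt a) e"
    proof
      fix e assume "e \<in> set es'"
      show "\<exists>a\<in>A' \<union> {q}. below (lead lt a) e"
      proof (cases "e = ?u")
        case False
        then have "e \<in> set es" using \<open>e \<in> set es'\<close> es'(3) by blast
        then obtain a where a: "a \<in> A" "below (lead lt a) e" using c by blast
        show ?thesis
        proof (cases "a \<in> GA")
          case True
          \<comment> \<open>\<open>a\<close> has left the triangular set, and \<open>q\<close> takes
            over its role below \<open>e\<close>.\<close>
          then have "below ?u e" using a(2) below_trans unfolding GA_def by blast
          then show ?thesis by blast
        qed (use a in \<open>auto simp: A'_def\<close>)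
      qed auto
    qed
  qed
  then show ?thesis unfolding upd controlled_def by auto
qed

text \<open>Serves the two branches that keep \<open>A\<close>, and hence the antichain,
  unchanged.\<close>

lemma controlled_by_extend:
  assumes "controlled_by es G D A H" "G' \<subseteq> G \<union> P" "D' \<subseteq> D" "H' \<subseteq> H \<union> P" "finite H'"
    and "\<And>f. f \<in> P \<Longrightarrow> weights_le (bound es (length es + 1)) f"
  shows "controlled_by es G' D' A H'"
proof -
  have "\<forall>f\<in>G' \<union> A \<union> H'. weights_le (bound es (length es + 1)) f"
    using assms(1,2,4,6) unfolding controlled_by_def by blast
  then show ?thesis
    using assms(1,3,5) unfolding controlled_by_def by blast
qed

text \<open>The leader of the remainder is a proper derivative of no member of \<open>es\<close>,
  because the remainder is reduced. This brings its weight under the bound; its initial, separant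
  and tails contain no further derivatives.\<close>

lemma controlled_successors:
  assumes "d_red_function d1 d2 lt dred"
    and ctl: "controlled_by es G D A H" and p: "p \<in> G \<union> D"
    and T: "T \<in> rg_successors d1 d2 lt (G - {p}) (D - {p}) A H (dred p A)"
  shows "controlled T"
proof -
  let ?q = "dred p A" and ?W = "bound es (length es + 1)"
  have weak: "weak_d_triangular lt A" using ctl by (simp add: controlled_by_def)
  then have red: "\<forall>g\<in>A. reduced lt ?q g" and rank: "rank_le lt ?q p"
    using assms(1) unfolding d_red_function_def by blast+
  have ctl': "controlled_by es (G - {p}) (D - {p}) A H"
    using ctl by (rule controlled_by_extend[where P = "{}"]) (use ctl in \<open>auto simp: controlled_by_def\<close>)
  show ?thesis
  proof (cases "?q \<in> ground")
    case True
    then show ?thesis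
      using T ctl' by (auto simp: rg_successors_def controlled_def split: if_splits)
  next
    case False
    have q0: "?q \<noteq> 0" using False by (auto simp flip: vars_eq_empty_iff)
    have below: "lead lt a = lead lt ?q" if "a \<in> A" "below (lead lt a) (lead lt ?q)" for a
    proof (rule ccontr)
      assume "lead lt a \<noteq> lead lt ?q"
      with that(2) obtain \<theta> where "\<theta> \<noteq> 0" "lead lt ?q = act \<theta> (lead lt a)"
        using proper_derivative_iff[of "lead lt ?q" "lead lt a"] by auto
      then show False
        using red that(1) lead_in_vars[OF False] unfolding reduced_def partially_reduced_def by metis
    qed
    have wq: "int (wt (lead lt ?q)) \<le> ?W"
    proof -
      obtain x where x: "x \<in> vars p" "wt (lead lt ?q) \<le> wt x"
        using rank_le_wt[OF rank lead_in_vars[OF False]] by blast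
      have "derivative_free (set es) (lead lt ?q)"
        unfolding derivative_free_def
      proof (intro ballI impI)
        fix e assume e: "e \<in> set es" "below e (lead lt ?q)"
        then obtain a where a: "a \<in> A" "below (lead lt a) e"
          using ctl unfolding controlled_by_def by blast
        then have "lead lt a = lead lt ?q" using below below_trans e by blast
        then show "e = lead lt ?q" using a e below_antisym by metis
      qed
      \<comment> \<open>Here \<open>p\<close> itself may exceed the bound; the clause for
        \<open>D\<close> is made for just such derivative-free leaders.\<close>
      then have "int (wt (lead lt ?q)) \<le> ?W" if "p \<in> D"
        using that x ctl unfolding controlled_by_def by blast
      moreover have "int (wt x) \<le> ?W" if "p \<in> G"
        using that x(1) ctl unfolding controlled_by_def weights_le_def by blast
      ultimately show ?thesis using p x(2) by fastforce
    qed
    then have wtq: "weights_le ?W ?q"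
      unfolding weights_le_def using wt_vars_le_lead by (meson of_nat_mono order_trans)
    note weights = weights_le_subset[OF _ wtq]
    have vi: "vars (init lt ?q) \<subseteq> vars ?q" and vs: "vars (sep lt ?q) \<subseteq> vars ?q"
      by (rule vars_init vars_sep)+
    have vl: "vars (Var (lead lt ?q)) \<subseteq> vars ?q" using lead_in_vars[OF False] by simp
    have vr: "vars (rank lt ?q) \<subseteq> vars ?q"
      unfolding rank_def using vars_power vl by (rule subset_trans)
    let ?qi = "?q - init lt ?q * rank lt ?q"
    let ?qs = "of_nat (deg_in (lead lt ?q) ?q) * ?q - Var (lead lt ?q) * sep lt ?q"
    have vqi: "vars ?qi \<subseteq> vars ?q"
      using vars_diff[of ?q "init lt ?q * rank lt ?q"] vars_mult[of "init lt ?q" "rank lt ?q"] vi vr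
      by blast
    have vqs: "vars ?qs \<subseteq> vars ?q"
      using vars_diff[of "of_nat (deg_in (lead lt ?q) ?q) * ?q" "Var (lead lt ?q) * sep lt ?q"]
        vars_mult[of "of_nat (deg_in (lead lt ?q) ?q)" ?q, unfolded vars_of_nat]
        vars_mult[of "Var (lead lt ?q)" "sep lt ?q"] vl vs by blast
    have "finite H" using ctl by (simp add: controlled_by_def)
    consider "T = update d1 d2 lt (G - {p}) (D - {p}) A H ?q"
      | "T = (G - {p} \<union> {?qs, sep lt ?q}, D - {p}, A, H \<union> {init lt ?q})"
      | "T = (G - {p} \<union> {?qi, init lt ?q}, D - {p}, A, H)"
      using T q0 False by (auto simp: rg_successors_def Let_def)
    then show ?thesis
    proof cases
      case 1
      then show ?thesis using controlled_update[OF ctl' False wq below] by simp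
    next
      case 2
      have "controlled_by es (G - {p} \<union> {?qs, sep lt ?q}) (D - {p}) A (H \<union> {init lt ?q})"
        by (rule controlled_by_extend[OF ctl', where P = "{?qs, sep lt ?q, init lt ?q}"])
          (use weights vqs vs vi \<open>finite H\<close> in auto)
      then show ?thesis unfolding 2 controlled_def by auto
    next
      case 3
      have "controlled_by es (G - {p} \<union> {?qi, init lt ?q}) (D - {p}) A H"
        by (rule controlled_by_extend[OF ctl', where P = "{?qi, init lt ?q}"])
          (use weights vqi vi \<open>finite H\<close> in auto)
      then show ?thesis unfolding 3 controlled_def by auto
    qed
  qed
qed


section \<open>The output\<close>

text \<open>The leaders of \<open>B\<close> stay among the leaders of \<open>A\<close> outside the
  remaining list. So \<open>B\<close> remains weak d-triangular, which
  \<open>pd_red_function\<close> presupposes.\<close>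

lemma weights_apr_loop:
  assumes pd: "pd_red_function d1 d2 lt pdred"
    and A: "weak_d_triangular lt A" "\<forall>f\<in>A. weights_le W f"
    and "apr_loop lt pdred A us B = Some B'"
    and "distinct us" "set us \<subseteq> lead lt ` A" "lead lt ` B \<subseteq> lead lt ` A - set us"
    and "finite B" "weak_d_triangular lt B" "\<forall>f\<in>B. weights_le W f"
  shows "finite B' \<and> weak_d_triangular lt B' \<and> (\<forall>f\<in>B'. weights_le W f)"
  using assms(4-)
proof (induction us arbitrary: B)
  case Nil
  then show ?case by simp
next
  case (Cons u us)
  define a where "a = (THE a. a \<in> A \<and> lead lt a = u)"
  define b where "b = pdred a B"
  have "\<exists>!a. a \<in> A \<and> lead lt a = u"
    using Cons.prems(3) A(1) by (auto simp: weak_d_triangular_def inj_on_def)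
  from theI'[OF this] have a: "a \<in> A" "lead lt a = u" by (simp_all add: a_def)
  have b: "b \<notin> ground" "rank lt b = rank lt a" and loop: "apr_loop lt pdred A us (insert b B) = Some B'"
    using Cons.prems(1) by (auto simp: Let_def a_def[symmetric] b_def split: if_splits)
  \<comment> \<open>The rank test preserves the leader, which is not yet a leader of
    \<open>B\<close>; so leaders remain distinct.\<close>
  have lb: "lead lt b = u" using lead_eq_if_rank_eq[OF b(2,1)] a by simp
  have "rank_le lt b a" using pd Cons.prems(6) unfolding pd_red_function_def b_def by blast
  then have wb: "weights_le W b" using A(2) a(1) weights_le_rank by blast
  have uB: "u \<notin> lead lt ` B" using Cons.prems(4) by auto
  have leads: "lead lt ` insert b B \<subseteq> lead lt ` A" 
    using Cons.prems(4) a(1) unfolding image_insert lb a(2)[symmetric] by blast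
  have "weak_d_triangular lt (insert b B)"
    unfolding weak_d_triangular_iff
  proof (intro conjI)
    show "insert b B \<inter> ground = {}" using b Cons.prems(6) by (auto simp: weak_d_triangular_iff)
    show "inj_on (lead lt) (insert b B)"
      using Cons.prems(6) uB lb unfolding weak_d_triangular_iff inj_on_insert by blast
    show "\<forall>f\<in>insert b B. \<forall>g\<in>insert b B. below (lead lt f) (lead lt g) \<longrightarrow> lead lt f = lead lt g"
    proof (intro ballI impI)
      fix f g assume fg: "f \<in> insert b B" "g \<in> insert b B" "below (lead lt f) (lead lt g)"
      have "lead lt f \<in> lead lt ` A" "lead lt g \<in> lead lt ` A" using leads fg(1,2) by blast+
      then show "lead lt f = lead lt g"
        using fg(3) A(1) unfolding weak_d_triangular_iff by (elim imageE) simp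
    qed
  qed
  moreover have "lead lt ` insert b B \<subseteq> lead lt ` A - set us"
    using leads Cons.prems(2,4) lb by auto
  ultimately show ?case
    using Cons.IH[OF loop] Cons.prems wb by auto
qed

text \<open>The output consists of elements of \<open>B\<close>, their initials and separants, and
  remainders of elements of \<open>H\<close>; none of these operations raises the weight.\<close>

lemma weights_auto_partial_reduce:
  assumes pd: "pd_red_function d1 d2 lt pdred"
    and "finite A" "finite H" "weak_d_triangular lt A" "\<forall>f\<in>A \<union> H. weights_le W f"
    and out: "(B, K) \<in> auto_partial_reduce lt pdred A H"
  shows "finite B \<and> finite K \<and> (\<forall>f\<in>B \<union> K. weights_le W f)"
proof -
  let ?us = "THE us. sorted_wrt lt us \<and> set us = lead lt ` A"
  interpret linorder "\<lambda>u v. lt u v \<or> u = v" lt by (rule lt_linorder)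
  have us: "sorted_wrt lt ?us \<and> set ?us = lead lt ` A"
    using \<open>finite A\<close> by (intro theI'[OF ex1_sorted_list_for_set_if_finite] finite_imageI)
  then have "distinct ?us" by (simp add: strict_sorted_iff)
  obtain B' where loop: "apr_loop lt pdred A ?us {} = Some B'"
    and BK: "B = B'" "K = initials_separants lt B' \<union> (\<lambda>q. pdred q B') ` (H - initials_separants lt A)"
    using out by (auto simp: auto_partial_reduce_def Let_def split: option.splits if_splits)
  have "weak_d_triangular lt {}" by (simp add: weak_d_triangular_iff)
  then have B': "finite B'" "weak_d_triangular lt B'" "\<forall>f\<in>B'. weights_le W f"
    using weights_apr_loop[OF pd assms(4) _ loop \<open>distinct ?us\<close>, of W] us assms(5) by auto
  have "rank_le lt (pdred q B') q" for q
    using pd B'(2) unfolding pd_red_function_def by blast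
  then have "\<forall>f\<in>(\<lambda>q. pdred q B') ` (H - initials_separants lt A). weights_le W f"
    using assms(5) weights_le_rank by blast
  then show ?thesis
    using B' weights_le_initials_separants[OF B'(3)] \<open>finite H\<close> unfolding BK
    by (auto simp: initials_separants_def)
qed

lemma finite_auto_partial_reduce: "finite (auto_partial_reduce lt pdred A H)"
  by (auto simp: auto_partial_reduce_def Let_def split: option.splits)

text \<open>Induction along the run with an invariant on both components of the state. Finiteness is
  carried along because \<open>set_weight\<close> is a \<open>Max\<close>.\<close>

lemma weights_rosenfeld_groebner:
  fixes F K :: "('k::field_char_0, 'y) diffpoly set"
  assumes pd: "pd_red_function d1 d2 lt pdred" and d: "d_red_function d1 d2 lt dred"
    and "finite K" "\<forall>f\<in>F \<union> K. weights_le (int h) f"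
    and run: "rosenfeld_groebner d1 d2 lt dred pdred F K Out"
  defines "M \<equiv> bound_seq CARD('y) h (max_antichain_length CARD('y) (bound_seq CARD('y) h) + 1)"
  shows "finite Out \<and> (\<forall>(A, H)\<in>Out. finite A \<and> finite H \<and> (\<forall>f\<in>A \<union> H. weights_le M f))"
proof -
  let ?I = "\<lambda>(S, Out). (\<forall>T\<in>S. controlled T) \<and> finite Out \<and>
      (\<forall>(A, H)\<in>Out. finite A \<and> finite H \<and> (\<forall>f\<in>A \<union> H. weights_le M f))"
  have invariant_step: "?I s'" if "rg_step d1 d2 lt dred pdred s s'" "?I s" for s s'
    using that
  proof (induction rule: rg_step.induct)
    case (finish G D A H S Out)
    then obtain es where es: "controlled_by es G D A H" by (auto simp: controlled_def)
    then have "bound es (length es + 1) \<le> M"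
      unfolding M_def by (intro bound_le_bound_seq) (simp add: controlled_by_def)
    then have "\<forall>f\<in>A \<union> H. weights_le M f"
      using es weights_le_trans unfolding controlled_by_def by blast
    then have "finite B \<and> finite K \<and> (\<forall>f\<in>B \<union> K. weights_le M f)"
      if "(B, K) \<in> auto_partial_reduce lt pdred A H" for B K
      using weights_auto_partial_reduce[OF pd _ _ _ _ that] es by (simp add: controlled_by_def)
    then show ?case using finish finite_auto_partial_reduce by auto
  next
    case (branch G D A H S p Out)
    then obtain es where "controlled_by es G D A H" by (auto simp: controlled_def)
    then have "controlled T" if "T \<in> rg_successors d1 d2 lt (G - {p}) (D - {p}) A H (dred p A)" for T
      using controlled_successors[OF d _ branch(2) that] by blast
    then show ?case using branch(3) by auto
  qed
  have "controlled (F, {}, {}, K)"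
  proof -
    \<comment> \<open>With no members recorded, the bound is taken at index 1, where it is
      \<open>h\<close>.\<close>
    have "bound [] (length [] + 1) = int h" using growth_one by (simp add: bound_def)
    then have "controlled_by [] F {} {} K"
      using assms(3,4) admissible_Nil by (simp add: controlled_by_def weak_d_triangular_iff)
    then show ?thesis by (auto simp: controlled_def)
  qed
  then have init: "?I ({(F, {}, {}, K)}, {})" by simp
  have "?I s'" if "(rg_step d1 d2 lt dred pdred)\<^sup>*\<^sup>* ({(F, {}, {}, K)}, {}) s'" for s'
    using that
  proof (induction rule: rtranclp_induct)
    case base
    show ?case by (rule init)
  next
    case (step s s')
    from step.hyps(2) step.IH show ?case by (rule invariant_step)
  qed
  from this[OF run[unfolded rosenfeld_groebner_def]] show ?thesis by simp
qed

end

theorem corollary28: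
  fixes d1 d2 :: "'k::field_char_0 \<Rightarrow> 'k"
    and c1 c2 n h L :: nat
    and lt :: "'y::finite derivative \<Rightarrow> 'y derivative \<Rightarrow> bool"
    and dred pdred :: "('k, 'y) diffpoly \<Rightarrow> ('k, 'y) diffpoly set \<Rightarrow> ('k, 'y) diffpoly"
    and F K :: "('k, 'y) diffpoly set"
    and Out :: "('k, 'y) rg_output"
  assumes "commuting_derivations d1 d2"
    and "n = CARD('y)"
    and "c1 > 0" and "c2 > 0"
    and "weighted_ranking c1 c2 lt"
    and "pd_red_function d1 d2 lt pdred"
    and "d_red_function d1 d2 lt dred"
    and "finite F" and "finite K"
    and "h = set_weight c1 c2 (F \<union> K)"
    and "L = max_antichain_length n (bound_seq n h)"
    and "rosenfeld_groebner d1 d2 lt dred pdred F K Out"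
  shows "int (set_weight c1 c2 (\<Union>(A, H)\<in>Out. A \<union> H)) \<le> bound_seq n h (L + 1)"
proof -
  interpret weighted_elimination c1 c2 h lt
    using assms by unfold_locales auto
  let ?M = "bound_seq n h (L + 1)" and ?U = "\<Union>(A, H)\<in>Out. A \<union> H"
  have "poly_weight c1 c2 f \<le> h" if "f \<in> F \<union> K" for f
    using that assms set_weight_le_iff[of "F \<union> K" c1 c2 h] by simp
  then have "\<forall>f\<in>F \<union> K. weights_le (int h) f"
    by (auto simp: weights_le_def poly_weight_le_iff)
  then have out: "finite Out" "\<forall>(A, H)\<in>Out. finite A \<and> finite H \<and> (\<forall>f\<in>A \<union> H. weights_le ?M f)"
    using weights_rosenfeld_groebner[OF assms(6,7,9) _ assms(12)] assms(2,11) by auto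
  \<comment> \<open>The comparison of weights passes through \<open>nat ?M\<close>. The empty
    antichain gives \<open>h\<close> as a lower bound for \<open>?M\<close>, so nothing is
    truncated.\<close>
  have M: "?M \<ge> 0"
    using bound_le_bound_seq[OF admissible_Nil] growth_one[of "CARD('y)" h] assms(2,11)
    by (simp add: bound_def)
  have "poly_weight c1 c2 f \<le> nat ?M" if "f \<in> ?U" for f
    unfolding poly_weight_le_iff
  proof
    fix v assume "v \<in> vars f"
    then have "int (weight c1 c2 v) \<le> ?M" using out(2) that by (fastforce simp: weights_le_def)
    then show "weight c1 c2 v \<le> nat ?M" by simp
  qed
  moreover have "finite ?U" using out by auto
  ultimately have "set_weight c1 c2 ?U \<le> nat ?M" by (simp add: set_weight_le_iff)
  then show ?thesis using M by simp
qed

end
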